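(* Assume the setting and standing assumption described in the context, and let $t_0\ge 1$. Suppose that for all $t\ge t_0$ $$1+\theta-\theta t\alpha(t)<0,\qquad (2\theta-1)\beta(t)+\theta t\dot\beta(t)\le 0,\qquad \alpha(t)+t\dot\alpha(t)<t\beta(t)\epsilon(t),$$ and that $\lim_{t\to+\infty}t^2\beta(t)\epsilon(t)=+\infty$. Let $(x_t,y_t)$ be the unique saddle point of $\mathcal{L}_t$ and set $$l(t)=\frac{1}{\theta t}\left(\beta(t)\epsilon(t)-\dot\alpha(t)-\frac{\alpha(t)}{t}\right),\qquad \Gamma(t)=\alpha(t)-\frac{1+\theta}{\theta t},$$ $$P_x(t)=-\beta(t)K^*\dot y_t-\beta(t)\dot\epsilon(t)x_t+\frac{\alpha(t)-t^{-1}}{\theta t}\dot x_t,$$ $$P_y(t)=\beta(t)K\dot x_t-\beta(t)\dot\epsilon(t)y_t+\frac{\alpha(t)-t^{-1}}{\theta t}\dot y_t,$$ $$\mathcal{R}(t)=\frac{\|P_x(t)\|^2+\|P_y(t)\|^2}{l(t)}+\frac{\|\dot x_t\|^2+\|\dot y_t\|^2}{2\theta^2t^2\Gamma(t)}$$ (so that $l(t)>0$ and $\Gamma(t)>0$ for all $t\ge t_0$). Assume further that $$\lim_{t\to+\infty}\frac{\int_{t_0}^{t}\tau^2\mathcal{R}(\tau)\,\mathrm{d}\tau}{t^2\beta(t)\epsilon(t)}=0.$$ Then every global solution $(x(t),y(t))$ of the system (GTRD) converges strongly to the minimum-norm saddle point $(\hat x^*,\hat y^* )=\operatorname{Proj}_\Omega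 0$, that is, $$\lim_{t\to+\infty}\|(x(t),y(t))-(\hat x^*,\hat y^* )\|=0.$$
   Context: Standing assumption: $f:\mathbb{R}^n\to\mathbb{R}$ and $g:\mathbb{R}^m\to\mathbb{R}$ are continuously differentiable convex functions whose gradients $\nabla f$, $\nabla g$ are $L_1$- and $L_2$-Lipschitz continuous, respectively, with $L_1,L_2>0$; $K\in\mathbb{R}^{m\times n}$ with adjoint $K^*$; $t_0>0$ and $\theta>0$ are constants; $\alpha,\beta,\epsilon:[t_0,+\infty)\to(0,+\infty)$ are of class $\mathcal{C}^1$, and $\epsilon$ is nonincreasing with $\lim_{t\to+\infty}\epsilon(t)=0$. Norms and inner products are Euclidean, $\|(x,y)\|=\sqrt{\|x\|^2+\|y\|^2}$. Lagrangian: $\mathcal{L}(x,y)=f(x)+\langle Kx,y\rangle-g(y)$ on $\mathbb{R}^n\times\mathbb{R}^m$. A pair $(x^*,y^* )$ is a saddle point of a function $\mathcal{M}$ if $\mathcal{M}(x^*,y)\le\mathcal{M}(x^*,y^* )\le\mathcal{M}(x,y^* )$ for all $(x,y)\in\mathbb{R}^n\times\mathbb{R}^m$; $\Omega$ is the set of saddle points of $\mathcal{L}$, assumed nonempty, closed and convex, and $\operatorname{Proj}_\Omega 0$ is the projection of the origin onto $\Omega$, i.e. the unique element of $\Omega$ of minimal norm. Regularized function: $\mathcal{L}_t(x,y)=\mathcal{L}(x,y)+\frac{\epsilon(t)}{2}(\|x\|^2-\|y\|^2)$; it is $\epsilon(t)$-strongly convex in $x$ and $\epsilon(t)$-strongly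 concave in $y$ and has a unique saddle point $(x_t,y_t)$. The map $t\mapsto(x_t,y_t)$ is locally Lipschitz on $[t_0,+\infty)$, and $\dot x_t,\dot y_t$ denote its derivatives with respect to $t$, which exist for almost every $t\ge t_0$; accordingly $P_x,P_y,\mathcal{R}$ are defined almost everywhere, and $\mathcal{R}$ is measurable and in $L^1_{\mathrm{loc}}([t_0,+\infty))$. System (GTRD), for $t\ge t_0$: $$\ddot x(t)+\alpha(t)\dot x(t)+\beta(t)\nabla_x\mathcal{L}_t\big(x(t),y(t)+\theta t\dot y(t)\big)=0,$$ $$\ddot y(t)+\alpha(t)\dot y(t)-\beta(t)\nabla_y\mathcal{L}_t\big(x(t)+\theta t\dot x(t),y(t)\big)=0,$$ where $\nabla_x\mathcal{L}_t(x,y)=\nabla f(x)+K^*y+\epsilon(t)x$ and $\nabla_y\mathcal{L}_t(x,y)=-\nabla g(y)+Kx-\epsilon(t)y$. A global solution is a global strong solution: $x\in W^{2,1}_{\mathrm{loc}}([t_0,+\infty);\mathbb{R}^n)$, $y\in W^{2,1}_{\mathrm{loc}}([t_0,+\infty);\mathbb{R}^m)$, satisfying the system for almost every $t>t_0$. *)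

theory Defs
  imports "HOL-Analysis.Analysis"
begin

definition lagrangian ::
  "(real^'n \<Rightarrow> real) \<Rightarrow> (real^'m \<Rightarrow> real) \<Rightarrow> real^'n^'m \<Rightarrow> real^'n \<Rightarrow> real^'m \<Rightarrow> real" where
  "lagrangian f g K x y = f x + (K *v x) \<bullet> y - g y"

definition reg_lagrangian ::
  "(real^'n \<Rightarrow> real) \<Rightarrow> (real^'m \<Rightarrow> real) \<Rightarrow> real^'n^'m \<Rightarrow> real \<Rightarrow> real^'n \<Rightarrow> real^'m \<Rightarrow> real" where
  "reg_lagrangian f g K e x y = lagrangian f g K x y + e / 2 * ((norm x)\<^sup>2 - (norm y)\<^sup>2)"

definition saddle_point :: "('a \<Rightarrow> 'b \<Rightarrow> real) \<Rightarrow> 'a \<times> 'b \<Rightarrow> bool" where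
  "saddle_point M p \<longleftrightarrow>
     (\<forall>x y. M (fst p) y \<le> M (fst p) (snd p) \<and> M (fst p) (snd p) \<le> M x (snd p))"

definition saddle_points :: "('a \<Rightarrow> 'b \<Rightarrow> real) \<Rightarrow> ('a \<times> 'b) set" where
  "saddle_points M = {p. saddle_point M p}"

text \<open>The unique saddle point of the regularized Lagrangian with parameter \<open>e > 0\<close>.\<close>

definition reg_saddle ::
  "(real^'n \<Rightarrow> real) \<Rightarrow> (real^'m \<Rightarrow> real) \<Rightarrow> real^'n^'m \<Rightarrow> real \<Rightarrow> (real^'n) \<times> (real^'m)" where
  "reg_saddle f g K e = (THE p. saddle_point (reg_lagrangian f g K e) p)"

text \<open>\<open>h\<close> is of class \<open>C\<^sup>1\<close> on \<open>[a, \<infinity>)\<close> with derivative \<open>h'\<close>; the derivative at \<open>a\<close> is one-sided.\<close>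

definition C1_from :: "real \<Rightarrow> (real \<Rightarrow> real) \<Rightarrow> (real \<Rightarrow> real) \<Rightarrow> bool" where
  "C1_from a h h' \<longleftrightarrow>
     (\<forall>t\<ge>a. (h has_real_derivative h' t) (at t within {a..})) \<and> continuous_on {a..} h'"

text \<open>\<open>u\<close> is (the continuous representative of) an element of \<open>W\<^sup>1\<^sup>,\<^sup>1\<^sub>l\<^sub>o\<^sub>c([a, \<infinity>))\<close> with derivative \<open>v\<close>,
  i.e. \<open>u\<close> is a primitive of the locally Lebesgue integrable function \<open>v\<close>. Local integrability on
  \<open>[a, \<infinity>)\<close> includes the endpoint \<open>a\<close>.\<close>

definition W11_loc_from :: "real \<Rightarrow> (real \<Rightarrow> 'a::euclidean_space) \<Rightarrow> (real \<Rightarrow> 'a) \<Rightarrow> bool" where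
  "W11_loc_from a u v \<longleftrightarrow>
     (\<forall>T\<ge>a. set_integrable lebesgue {a..T} v) \<and>
     (\<forall>t\<ge>a. u t = u a + (LINT s:{a..t}|lebesgue. v s))"

text \<open>\<open>\<nabla>\<^sub>x\<close> and \<open>\<nabla>\<^sub>y\<close> of the regularized Lagrangian, in terms of the gradients \<open>gf\<close> of \<open>f\<close> and \<open>gg\<close>
  of \<open>g\<close>; the adjoint of \<open>K\<close> is its transpose.\<close>

definition grad_x_reg ::
  "(real^'n \<Rightarrow> real^'n) \<Rightarrow> real^'n^'m \<Rightarrow> real \<Rightarrow> real^'n \<Rightarrow> real^'m \<Rightarrow> real^'n" where
  "grad_x_reg gf K e x y = gf x + transpose K *v y + e *\<^sub>R x"

definition grad_y_reg ::
  "(real^'m \<Rightarrow> real^'m) \<Rightarrow> real^'n^'m \<Rightarrow> real \<Rightarrow> real^'n \<Rightarrow> real^'m \<Rightarrow> real^'m" where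
  "grad_y_reg gg K e x y = - gg y + K *v x - e *\<^sub>R y"

text \<open>Global strong solutions: \<open>x\<close> and \<open>y\<close> are in \<open>W\<^sup>2\<^sup>,\<^sup>1\<^sub>l\<^sub>o\<^sub>c([t\<^sub>0, \<infinity>))\<close>, with first derivatives \<open>x'\<close>, \<open>y'\<close>
  and second derivatives \<open>x''\<close>, \<open>y''\<close>.\<close>

definition gtrd_solution ::
  "(real^'n \<Rightarrow> real^'n) \<Rightarrow> (real^'m \<Rightarrow> real^'m) \<Rightarrow> real^'n^'m \<Rightarrow> real \<Rightarrow> real \<Rightarrow>
   (real \<Rightarrow> real) \<Rightarrow> (real \<Rightarrow> real) \<Rightarrow> (real \<Rightarrow> real) \<Rightarrow> (real \<Rightarrow> real^'n) \<Rightarrow> (real \<Rightarrow> real^'m) \<Rightarrow> bool" where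
  "gtrd_solution gf gg K t0 \<theta> \<alpha> \<beta> \<epsilon> x y \<longleftrightarrow>
     (\<exists>x' x'' y' y''.
        W11_loc_from t0 x x' \<and> W11_loc_from t0 x' x'' \<and>
        W11_loc_from t0 y y' \<and> W11_loc_from t0 y' y'' \<and>
        (AE t in lebesgue. t > t0 \<longrightarrow>
           x'' t + \<alpha> t *\<^sub>R x' t
             + \<beta> t *\<^sub>R grad_x_reg gf K (\<epsilon> t) (x t) (y t + (\<theta> * t) *\<^sub>R y' t) = 0 \<and>
           y'' t + \<alpha> t *\<^sub>R y' t
             - \<beta> t *\<^sub>R grad_y_reg gg K (\<epsilon> t) (x t + (\<theta> * t) *\<^sub>R x' t) (y t) = 0))"

end

theory Submission
  imports Defs
begin

text \<open>
  Write \<open>z = (x, y)\<close> in the product space, \<open>\<phi> (x, y) = f x + g y\<close> with gradient \<open>G\<close>, and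
  \<open>J (x, y) = (K\<^sup>T y, - K x)\<close>, which is linear and skew. The saddle points of the Lagrangian
  regularized with \<open>e \<ge> 0\<close> are the zeros of \<open>F\<^sub>e u = G u + J u + e u\<close>, and the system becomes
  \<open>z'' + \<alpha> z' + \<beta> (G z + \<epsilon> z + J (z + \<theta> t z')) = 0\<close>. All of the analysis is done for such a pair
  \<open>(\<phi>, J)\<close> on a Euclidean space.

  For \<open>e > 0\<close> the operator \<open>F\<^sub>e\<close> is Lipschitz and \<open>e\<close>-strongly monotone, so that it has exactly
  one zero \<open>s\<^sub>e\<close> (Banach's fixed point theorem). Strong monotonicity also shows that \<open>s\<^sub>e\<close> is locally
  Lipschitz in \<open>e\<close>, and that \<open>|s\<^sub>e|\<^sup>2 \<le> s\<^sub>e \<bullet> q\<close> for every zero \<open>q\<close> of \<open>F\<^sub>0\<close>; by compactness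
  \<open>s\<^sub>e\<close> tends to the zero of \<open>F\<^sub>0\<close> of least norm as \<open>e\<close> tends to \<open>0\<close> (\<open>zero_path_limit\<close>).

  It remains to show \<open>z t - s t \<longlongrightarrow> 0\<close>, where \<open>s t\<close> is the zero of \<open>F\<^sub>e\<close> for \<open>e = \<epsilon> t\<close>. Let \<open>D\<close> be
  the primal-dual gap of \<open>z\<close> relative to \<open>s\<close>. The energy
  \<open>E = \<theta>\<^sup>2 t\<^sup>2 \<beta> D + |z - s + \<theta> t z'|\<^sup>2 / 2 + (\<theta> t \<alpha> - 1 - \<theta>) |z - s|\<^sup>2 / 2\<close>
  satisfies \<open>E' \<le> \<theta>\<^sup>2 t\<^sup>2 R / 2\<close> almost everywhere (\<open>energy_dissipation\<close>): the pairings
  of the velocity with \<open>G\<close> and \<open>J\<close> cancel, thanks to the extrapolated argument \<open>z + \<theta> t z'\<close> of \<open>J\<close>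
  and to skewness, and the terms that come from the motion of \<open>s\<close> are absorbed by completing
  two squares. Since \<open>D \<ge> \<epsilon> |z - s|\<^sup>2 / 2\<close>, integration bounds \<open>t\<^sup>2 \<beta> \<epsilon> |z - s|\<^sup>2\<close> by a constant plus
  the integral of \<open>\<tau>\<^sup>2 R\<close>, and the growth hypotheses finish the proof.

  The path \<open>s\<close> is only Lipschitz in time. Its differentiability almost everywhere, and the
  fundamental theorem of calculus for the energy, come from \<open>lipschitz_AE_derivative\<close>. That
  \<open>R\<close> is locally integrable has to be proved as well (\<open>residual_integrable\<close>).
\<close>

section \<open>Lipschitz functions of one real variable\<close>

text \<open>
  Lebesgue's differentiation theorem \<open>integrable_ccontinuous_explicit\<close> gives difference
  quotients to the right of \<open>t\<close>; those to the left come from the reflected function.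
\<close>

lemma indefinite_integral_AE_derivative:
  fixes h u :: "real \<Rightarrow> real"
  assumes int: "\<And>a b. h integrable_on {a..b}"
    and u: "\<And>a b. a \<le> b \<Longrightarrow> u b - u a = integral {a..b} h"
  obtains N where "negligible N" "\<And>t. t \<notin> N \<Longrightarrow> (u has_real_derivative h t) (at t)"
proof -
  have int': "(\<lambda>t. h (- t)) integrable_on {a..b}" for a b
    using int[of "-b" "-a"] Henstock_Kurzweil_Integration.integrable_reflect_real[of h "-a" "-b"]
    by simp
  obtain N1 where N1: "negligible N1" "\<And>x e. \<lbrakk>x \<notin> N1; 0 < e\<rbrakk> \<Longrightarrow>
      \<exists>d>0. \<forall>k. 0 < k \<and> k < d \<longrightarrow> norm (integral {x..x + k} h /\<^sub>R k - h x) < e"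
    using integrable_ccontinuous_explicit[of h] int by (auto simp: cbox_interval)
  obtain N2 where N2: "negligible N2" "\<And>x e. \<lbrakk>x \<notin> N2; 0 < e\<rbrakk> \<Longrightarrow>
      \<exists>d>0. \<forall>k. 0 < k \<and> k < d \<longrightarrow>
        norm (integral {x..x + k} (\<lambda>t. h (- t)) /\<^sub>R k - h (- x)) < e"
    using integrable_ccontinuous_explicit[of "\<lambda>t. h (- t)"] int' by (auto simp: cbox_interval)
  have "negligible (uminus ` N2)"
    by (rule negligible_locally_Lipschitz_image[OF _ N2(1)])
      (auto intro!: exI[of _ "UNIV :: real set"] exI[of _ "1 :: real"] simp: abs_minus_commute)
  then have neg: "negligible (N1 \<union> uminus ` N2)" using N1 by simp
  have "(u has_real_derivative h t) (at t)" if t: "t \<notin> N1 \<union> uminus ` N2" for t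
    unfolding DERIV_def LIM_def
  proof (intro allI impI)
    fix e :: real assume e: "e > 0"
    have "t \<notin> N1" "- t \<notin> N2" using t by (auto intro: rev_image_eqI)
    then obtain d1 d2 where d: "d1 > 0" "d2 > 0"
      and d1: "\<And>k. 0 < k \<Longrightarrow> k < d1 \<Longrightarrow> \<bar>integral {t..t + k} h /\<^sub>R k - h t\<bar> < e"
      and d2: "\<And>k. 0 < k \<Longrightarrow> k < d2 \<Longrightarrow>
        \<bar>integral {-t..-t + k} (\<lambda>t. h (- t)) /\<^sub>R k - h t\<bar> < e"
      using N1(2)[OF _ e, of t] N2(2)[OF _ e, of "-t"] by auto
    have "\<bar>(u (t + k) - u t) / k - h t\<bar> < e" if k: "k \<noteq> 0" "\<bar>k\<bar> < min d1 d2" for k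
    proof (cases "k > 0")
      case True
      then show ?thesis using d1[of k] k u[of t "t+k"] by (simp add: field_simps)
    next
      case False
      have "integral {-t..-t + -k} (\<lambda>t. h (- t)) = integral {t+k..t} h"
        using Henstock_Kurzweil_Integration.integral_reflect_real[of t "t+k" h] by (simp add: algebra_simps)
      also have "\<dots> = u t - u (t + k)" using u[of "t+k" t] False by simp
      finally show ?thesis using d2[of "-k"] k False by (simp add: field_simps)
    qed
    then show "\<exists>s>0. \<forall>x. x \<noteq> 0 \<and> dist x 0 < s \<longrightarrow> dist ((u (t + x) - u t) / x) (h t) < e"
      using d by (intro exI[of _ "min d1 d2"]) (auto simp: dist_real_def)
  qed
  then show ?thesis using neg that by blast
qed

text \<open>
  A Lipschitz function is the integral of its almost everywhere derivative. Adding a multiple of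
  the identity makes it a bi-Lipschitz increasing bijection \<open>G\<close> of the line. The image of Lebesgue
  measure under the inverse of \<open>G\<close> is absolutely continuous, as Lipschitz maps
  preserve null sets, and its Radon-Nikodym density is the derivative of \<open>G\<close>.
\<close>

lemma lipschitz_AE_derivative:
  fixes u :: "real \<Rightarrow> real"
  assumes lip: "L-lipschitz_on UNIV u"
  obtains h N where "\<And>a b. h integrable_on {a..b}"
    "\<And>a b. a \<le> b \<Longrightarrow> u b - u a = integral {a..b} h"
    "negligible N" "\<And>t. t \<notin> N \<Longrightarrow> (u has_real_derivative h t) (at t)"
proof -
  have L0: "L \<ge> 0" using lip lipschitz_on_nonneg by blast
  define G where "G = (\<lambda>t. u t + (L + 1) * t)"
  have ub: "\<bar>u s - u t\<bar> \<le> L * (s - t)" if "t \<le> s" for s t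
    using lipschitz_onD[OF lip, of s t] that by (simp add: dist_real_def)
  have lo: "G s - G t \<ge> s - t" if "t \<le> s" for s t
    using ub[OF that] unfolding G_def by (auto simp: algebra_simps)
  have hi: "\<bar>G s - G t\<bar> \<le> (2 * L + 1) * \<bar>s - t\<bar>" for s t
  proof -
    have "\<bar>G s - G t\<bar> = \<bar>(u s - u t) + (L + 1) * (s - t)\<bar>" by (simp add: G_def algebra_simps)
    also have "\<dots> \<le> \<bar>u s - u t\<bar> + (L + 1) * \<bar>s - t\<bar>"
      using L0 abs_triangle_ineq[of "u s - u t" "(L + 1) * (s - t)"] by (simp add: abs_mult)
    also have "\<dots> \<le> L * \<bar>s - t\<bar> + (L + 1) * \<bar>s - t\<bar>"
      using lipschitz_onD[OF lip, of s t] by (simp add: dist_real_def)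
    finally show ?thesis by (simp add: algebra_simps)
  qed
  have contG: "continuous_on UNIV G"
    unfolding G_def using lipschitz_on_continuous_on[OF lip] by (intro continuous_intros)
  have mono: "G t < G s" if "t < s" for s t using lo[of t s] that by simp
  have inj: "inj G"
    by (rule linorder_injI) (use mono in force)
  have surj: "surj G"
  unfolding surj_def
  proof
    fix v
    define c where "c = \<bar>v - G 0\<bar>"
    have "G (- c) \<le> v" "v \<le> G c" using lo[of "-c" 0] lo[of 0 c] by (auto simp: c_def)
    moreover have "continuous_on {-c..c} G" using contG continuous_on_subset by blast
    ultimately show "\<exists>x. v = G x" using IVT'[of G "-c" v c] by (auto simp: c_def)
  qed
  define k where "k = inv G"
  have kG: "k (G t) = t" and Gk: "G (k t) = t" for t
    using inj surj by (simp_all add: k_def surj_f_inv_f)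
  have le_iff: "G s \<le> G t \<longleftrightarrow> s \<le> t" for s t
    using mono[of s t] mono[of t s] by (cases s t rule: linorder_cases) auto
  have kmono: "mono k"
    by (rule monoI) (use le_iff Gk in metis)
  have kmeas[measurable]: "k \<in> borel_measurable borel" using kmono by (rule borel_measurable_mono)
  define M where "M = distr lborel borel k"
  have vim: "k -` A = G ` A" for A :: "real set" using kG Gk by (auto intro: rev_image_eqI)
  have "absolutely_continuous lborel M"
    unfolding absolutely_continuous_def
  proof
    fix A :: "real set" assume A: "A \<in> null_sets lborel"
    then have "negligible A" using negligible_iff_null_sets null_sets_completionI by blast
    then have "negligible (G ` A)"
      using hi by (intro negligible_locally_Lipschitz_image[where f=G])
        (auto intro!: exI[of _ UNIV] exI[of _ "2 * L + 1"])
    then have "k -` A \<in> null_sets (completion lborel)"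
      by (simp add: vim negligible_iff_null_sets)
    moreover have "k -` A \<in> sets lborel"
      using A measurable_sets_borel[OF kmeas, of A] by auto
    ultimately have "k -` A \<in> null_sets lborel" by (simp add: null_sets_completion_iff)
    then show "A \<in> null_sets M" using A by (auto simp: M_def null_sets_distr_iff)
  qed
  then obtain D where D[measurable]: "D \<in> borel_measurable lborel" and DM: "density lborel D = M"
    using sigma_finite_measure.Radon_Nikodym[OF lborel.sigma_finite_measure_axioms, of M] by (auto simp: M_def)
  have Gimg: "G ` {a..b} = {G a..G b}" if "a \<le> b" for a b :: real
  proof (rule set_eqI)
    fix y
    have "y \<in> G ` {a..b} \<longleftrightarrow> k y \<in> {a..b}" using kG Gk by (auto intro: rev_image_eqI)
    also have "\<dots> \<longleftrightarrow> y \<in> {G a..G b}" using le_iff[of a "k y"] le_iff[of "k y" b] Gk by simp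
    finally show "y \<in> G ` {a..b} \<longleftrightarrow> y \<in> {G a..G b}" .
  qed
  have nn: "(\<integral>\<^sup>+t. D t * indicator {a..b} t \<partial>lborel) = ennreal (G b - G a)" if "a \<le> b" for a b
  proof -
    have "(\<integral>\<^sup>+t. D t * indicator {a..b} t \<partial>lborel) = emeasure M {a..b}"
      unfolding DM[symmetric] by (subst emeasure_density) auto
    also have "\<dots> = emeasure lborel (k -` {a..b})"
      unfolding M_def by (subst emeasure_distr) auto
    also have "\<dots> = ennreal (G b - G a)"
      unfolding vim Gimg[OF that] using lo[OF that] that by simp
    finally show ?thesis .
  qed
  have hi0: "((\<lambda>t. enn2real (D t)) has_integral (G b - G a)) {a..b}" if ab: "a \<le> b" for a b
  proof -
    have "AE t in lborel. D t * indicator {a..b} t \<noteq> \<infinity>"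
      by (rule nn_integral_PInf_AE) (use nn[OF ab] in auto)
    then have "(\<integral>\<^sup>+t. D t * indicator {a..b} t \<partial>lborel) =
        (\<integral>\<^sup>+t. ennreal (enn2real (D t) * indicator {a..b} t) \<partial>lborel)"
      by (intro nn_integral_cong_AE) (auto simp: indicator_def less_top elim!: eventually_mono)
    then have "(\<integral>\<^sup>+t. ennreal (enn2real (D t) * indicator {a..b} t) \<partial>lborel) = ennreal (G b - G a)"
      using nn[OF ab] by simp
    then have "((\<lambda>t. enn2real (D t) * indicator {a..b} t) has_integral (G b - G a)) UNIV"
      using lo[OF ab] ab by (intro nn_integral_has_integral) auto
    also have "(\<lambda>t. enn2real (D t) * indicator {a..b} t) =
        (\<lambda>t. if t \<in> {a..b} then enn2real (D t) else 0)" by (auto simp: indicator_def)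
    finally show ?thesis by (simp only: has_integral_restrict_UNIV)
  qed
  define h where "h t = enn2real (D t) - (L + 1)" for t
  have hu: "(h has_integral (u b - u a)) {a..b}" if "a \<le> b" for a b
    using has_integral_diff[OF hi0[OF that] has_integral_const_real[of "L+1" a b]] that
    by (simp add: h_def[abs_def] G_def algebra_simps)
  have 1: "h integrable_on {a..b}" for a b using hu[of a b] by (cases "a \<le> b") auto
  have 2: "u b - u a = integral {a..b} h" if "a \<le> b" for a b
    using hu[OF that] by (simp add: integral_unique)
  obtain N where "negligible N" "\<And>t. t \<notin> N \<Longrightarrow> (u has_real_derivative h t) (at t)"
    using indefinite_integral_AE_derivative[of h u, OF 1 2] by blast
  then show ?thesis by (intro that[of h N] 1 2)
qed

lemma lipschitz_real_vector_derivative_norm_le: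
  fixes u :: "real \<Rightarrow> 'a::real_normed_vector"
  assumes lip: "C-lipschitz_on {a..b} u" and t: "t \<in> {a<..<b}"
    and der: "(u has_vector_derivative D) (at t)"
  shows "norm D \<le> C"
proof -
  have "((\<lambda>s. (1 / norm (s - t)) *\<^sub>R (u s - (u t + (s - t) *\<^sub>R D))) \<longlongrightarrow> 0) (at t)"
    using der unfolding has_vector_derivative_def has_derivative_at2 by simp
  then have "((\<lambda>s. norm ((1 / norm (s - t)) *\<^sub>R (u s - (u t + (s - t) *\<^sub>R D)))) \<longlongrightarrow> 0) (at t)"
    by (rule tendsto_norm_zero)
  moreover have "norm ((1 / norm (s - t)) *\<^sub>R (u s - (u t + (s - t) *\<^sub>R D))) =
      norm ((u s - u t) /\<^sub>R (s - t) - D)" if "s \<noteq> t" for s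
  proof -
    have "(u s - u t) /\<^sub>R (s - t) - D = (u s - (u t + (s - t) *\<^sub>R D)) /\<^sub>R (s - t)"
    proof -
      have "((s - t) *\<^sub>R D) /\<^sub>R (s - t) = D" using that by simp
      then show ?thesis
        unfolding diff_diff_add[symmetric] by (subst scaleR_diff_right) (simp only:)
    qed
    then show ?thesis by (simp add: divide_inverse)
  qed
  ultimately have "((\<lambda>s. norm ((u s - u t) /\<^sub>R (s - t) - D)) \<longlongrightarrow> 0) (at t)"
    by (subst Lim_cong_within[where g="\<lambda>s. norm ((1 / norm (s - t)) *\<^sub>R (u s - (u t + (s - t) *\<^sub>R D)))"])
      auto
  then have "((\<lambda>s. (u s - u t) /\<^sub>R (s - t)) \<longlongrightarrow> D) (at t)"
    by (subst Lim_null) (rule tendsto_norm_zero_cancel)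
  then have *: "((\<lambda>s. norm ((u s - u t) /\<^sub>R (s - t))) \<longlongrightarrow> norm D) (at t)" by (rule tendsto_norm)
  have "eventually (\<lambda>s. s \<in> {a<..<b}) (at t)"
    using t by (intro eventually_at_in_open') auto
  moreover have "eventually (\<lambda>s. s \<noteq> t) (at t)" by (simp add: eventually_at_filter)
  ultimately have "eventually (\<lambda>s. norm ((u s - u t) /\<^sub>R (s - t)) \<le> C) (at t)"
  proof eventually_elim
    case (elim s)
    have "norm ((u s - u t) /\<^sub>R (s - t)) = norm (u s - u t) / \<bar>s - t\<bar>"
      by (simp add: divide_inverse mult.commute)
    then show ?case using lipschitz_onD[OF lip, of s t] t elim
      by (simp add: dist_norm dist_real_def pos_divide_le_eq)
  qed
  then show ?thesis by (rule tendsto_upperbound[OF *]) simp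
qed

text \<open>
  The version on an interval with values in a Euclidean space, by components; outside the interval
  \<open>u\<close> is extended by its values at the endpoints. The derivative is replaced by \<open>0\<close> on the
  exceptional set, so that its bound holds everywhere.
\<close>

lemma lipschitz_AE_vector_derivative:
  fixes u :: "real \<Rightarrow> 'a::euclidean_space"
  assumes lip: "C-lipschitz_on {a..b} u" and ab: "a \<le> b"
  obtains h N where "h integrable_on {a..b}" "u b - u a = integral {a..b} h"
    "negligible N" "\<And>t. t \<in> {a<..<b} \<Longrightarrow> t \<notin> N \<Longrightarrow> (u has_vector_derivative h t) (at t)"
    "\<And>t. t \<in> {a..b} \<Longrightarrow> norm (h t) \<le> C"
proof -
  \<comment> \<open>\<open>c\<close> is the projection of the line onto the interval.\<close>
  define c where "c t = max a (min b t)" for t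
  have c: "c t \<in> {a..b}" "t \<in> {a..b} \<Longrightarrow> c t = t" for t using ab by (auto simp: c_def)
  have cl: "\<bar>c s - c t\<bar> \<le> \<bar>s - t\<bar>" for s t by (auto simp: c_def max_def min_def)
  have C0: "C \<ge> 0" using lip lipschitz_on_nonneg by blast
  define P where "P i h N \<longleftrightarrow> (\<forall>a b. h integrable_on {a..b}) \<and>
      (\<forall>a b. a \<le> b \<longrightarrow> u (c b) \<bullet> i - u (c a) \<bullet> i = integral {a..b} h) \<and> negligible N \<and>
      (\<forall>t. t \<notin> N \<longrightarrow> ((\<lambda>s. u (c s) \<bullet> i) has_real_derivative h t) (at t))" for i h N
  have ex: "\<exists>h N. P i h N" if "i \<in> Basis" for i
  proof -
    have "C-lipschitz_on UNIV (\<lambda>t. u (c t) \<bullet> i)"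
    proof (rule lipschitz_onI)
      fix s t
      have "dist (u (c s) \<bullet> i) (u (c t) \<bullet> i) = \<bar>(u (c s) - u (c t)) \<bullet> i\<bar>"
        by (simp add: dist_real_def inner_diff_left)
      also have "\<dots> \<le> norm (u (c s) - u (c t))" using that by (rule Basis_le_norm)
      also have "\<dots> \<le> C * \<bar>c s - c t\<bar>"
        using lipschitz_onD[OF lip c(1) c(1), of s t] by (simp add: dist_norm dist_real_def)
      also have "\<dots> \<le> C * \<bar>s - t\<bar>" by (intro mult_left_mono cl C0)
      finally show "dist (u (c s) \<bullet> i) (u (c t) \<bullet> i) \<le> C * dist s t" by (simp add: dist_real_def)
    qed (rule C0)
    then obtain h N where "\<And>a b. h integrable_on {a..b}"
      "\<And>a b. a \<le> b \<Longrightarrow> u (c b) \<bullet> i - u (c a) \<bullet> i = integral {a..b} h"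
      "negligible N" "\<And>t. t \<notin> N \<Longrightarrow> ((\<lambda>s. u (c s) \<bullet> i) has_real_derivative h t) (at t)"
      by (rule lipschitz_AE_derivative) blast
    then have "P i h N" unfolding P_def by simp
    then show ?thesis by blast
  qed
  obtain h N where "\<And>i. i \<in> Basis \<Longrightarrow> P i (h i) (N i)" using ex by metis
  then have h: "\<And>i a b. i \<in> Basis \<Longrightarrow> h i integrable_on {a..b}"
    "\<And>i a b. i \<in> Basis \<Longrightarrow> a \<le> b \<Longrightarrow> u (c b) \<bullet> i - u (c a) \<bullet> i = integral {a..b} (h i)"
    and N: "\<And>i. i \<in> Basis \<Longrightarrow> negligible (N i)"
    and d: "\<And>i t. i \<in> Basis \<Longrightarrow> t \<notin> N i \<Longrightarrow>
      ((\<lambda>s. u (c s) \<bullet> i) has_real_derivative h i t) (at t)" unfolding P_def by simp_all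
  define M where "M = (\<Union>i\<in>Basis. N i)"
  have M: "negligible M" unfolding M_def using N by (intro negligible_Union) auto
  define k where "k t = (\<Sum>i\<in>Basis. h i t *\<^sub>R i)" for t
  have ki: "k t \<bullet> i = h i t" if "i \<in> Basis" for i t using that by (simp add: k_def)
  have der: "(u has_vector_derivative k t) (at t)" if t: "t \<in> {a<..<b}" "t \<notin> M" for t
  proof -
    have "((\<lambda>s. u (c s)) has_vector_derivative k t) (at t)"
      unfolding has_vector_derivative_def
    proof (subst has_derivative_componentwise_within, intro ballI)
      fix i :: 'a assume i: "i \<in> Basis"
      show "((\<lambda>s. u (c s) \<bullet> i) has_derivative (\<lambda>x. (x *\<^sub>R k t) \<bullet> i)) (at t)"
        using d[OF i, of t] t i unfolding has_field_derivative_def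
        by (simp add: ki M_def mult_commute_abs)
    qed
    then show ?thesis
      by (rule has_vector_derivative_transform_within_open[where S="{a<..<b}"])
        (use t c(2) in auto)
  qed
  define k' where "k' t = (if t \<in> {a<..<b} - M then k t else 0)" for t
  have negl: "negligible (M \<union> {a, b})" using M by simp
  have kint: "(k has_integral (u b - u a)) {a..b}"
  proof (rule has_integral_componentwise)
    fix i :: 'a assume i: "i \<in> Basis"
    show "((\<lambda>x. k x \<bullet> i) has_integral (u b - u a) \<bullet> i) {a..b}"
      using integrable_integral[OF h(1)[OF i], of a b] h(2)[OF i ab] c(2) ab i
      by (simp add: ki inner_diff_left)
  qed
  have kint': "(k' has_integral (u b - u a)) {a..b}"
    by (rule has_integral_spike[OF negl _ kint]) (auto simp: k'_def)
  show ?thesis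
  proof
    show "k' integrable_on {a..b}" "u b - u a = integral {a..b} k'"
      using kint' by (auto simp: integral_unique)
    show "negligible M" by (rule M)
    show "(u has_vector_derivative k' t) (at t)" if "t \<in> {a<..<b}" "t \<notin> M" for t
      using der that by (simp add: k'_def)
    show "norm (k' t) \<le> C" if "t \<in> {a..b}" for t
      using lipschitz_real_vector_derivative_norm_le[OF lip] der C0 by (auto simp: k'_def)
  qed
qed

lemma lipschitz_growth_le_integral:
  fixes u q :: "real \<Rightarrow> real"
  assumes lip: "C-lipschitz_on {a..b} u" and ab: "a \<le> b"
    and q: "q integrable_on {a..b}" and N: "negligible N"
    and le: "\<And>t D. \<lbrakk>t \<in> {a<..<b}; t \<notin> N; (u has_real_derivative D) (at t)\<rbrakk> \<Longrightarrow> D \<le> q t"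
  shows "u b - u a \<le> integral {a..b} q"
proof -
  obtain h M where h: "h integrable_on {a..b}" "u b - u a = integral {a..b} h"
    and M: "negligible M" "\<And>t. t \<in> {a<..<b} \<Longrightarrow> t \<notin> M \<Longrightarrow> (u has_vector_derivative h t) (at t)"
    using lipschitz_AE_vector_derivative[OF lip ab] by metis
  have "integral {a..b} h \<le> integral {a..b} (\<lambda>t. if t \<in> N \<union> M \<union> {a, b} then h t else q t)"
  proof (rule integral_le[OF h(1)])
    show "(\<lambda>t. if t \<in> N \<union> M \<union> {a, b} then h t else q t) integrable_on {a..b}"
      by (rule integrable_spike[OF q, of "N \<union> M \<union> {a, b}"]) (use N M in auto)
    show "h t \<le> (if t \<in> N \<union> M \<union> {a, b} then h t else q t)" if "t \<in> {a..b}" for t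
      using le[of t "h t"] M(2)[of t] that by (auto simp: has_real_derivative_iff_has_vector_derivative)
  qed
  also have "\<dots> = integral {a..b} q"
    by (rule integral_spike[of "N \<union> M \<union> {a, b}"]) (use N M in auto)
  finally show ?thesis using h(2) by simp
qed

lemma lipschitz_Icc_bounded:
  fixes u :: "real \<Rightarrow> 'a::real_normed_vector"
  assumes "C-lipschitz_on {a..b} u"
  obtains U where "U > 0" "\<And>t. t \<in> {a..b} \<Longrightarrow> norm (u t) \<le> U"
proof -
  have "bounded (u ` {a..b})"
    by (intro compact_imp_bounded compact_continuous_image lipschitz_on_continuous_on[OF assms] compact_Icc)
  then show ?thesis using that unfolding bounded_pos by blast
qed

lemma lipschitz_bilinear_Icc:
  fixes u :: "real \<Rightarrow> 'a::real_normed_vector" and w :: "real \<Rightarrow> 'b::real_normed_vector"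
    and pr :: "'a \<Rightarrow> 'b \<Rightarrow> 'c::real_normed_vector"
  assumes "bounded_bilinear pr" "\<exists>C. C-lipschitz_on {a..b} u" "\<exists>C. C-lipschitz_on {a..b} w"
  shows "\<exists>C. C-lipschitz_on {a..b} (\<lambda>t. pr (u t) (w t))"
proof -
  interpret bounded_bilinear pr by fact
  obtain C D where C: "C-lipschitz_on {a..b} u" and D: "D-lipschitz_on {a..b} w" using assms by auto
  obtain U where U: "U > 0" "\<And>t. t \<in> {a..b} \<Longrightarrow> norm (u t) \<le> U"
    using lipschitz_Icc_bounded[OF C] by blast
  obtain W where W: "W > 0" "\<And>t. t \<in> {a..b} \<Longrightarrow> norm (w t) \<le> W"
    using lipschitz_Icc_bounded[OF D] by blast
  obtain M where M: "M > 0" "\<And>x y. norm (pr x y) \<le> norm x * norm y * M"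
    using pos_bounded by blast
  have C0: "C \<ge> 0" "D \<ge> 0" using C D lipschitz_on_nonneg by blast+
  have "((C * W + U * D) * M)-lipschitz_on {a..b} (\<lambda>t. pr (u t) (w t))"
  proof (rule lipschitz_onI)
    fix s t assume st: "s \<in> {a..b}" "t \<in> {a..b}"
    have "norm (pr (u s) (w s) - pr (u t) (w t)) = norm (pr (u s - u t) (w s) + pr (u t) (w s - w t))"
      by (simp add: diff_left diff_right)
    also have "\<dots> \<le> norm (pr (u s - u t) (w s)) + norm (pr (u t) (w s - w t))"
      by (rule norm_triangle_ineq)
    also have "\<dots> \<le> norm (u s - u t) * norm (w s) * M + norm (u t) * norm (w s - w t) * M"
      by (intro add_mono M(2))
    also have "\<dots> \<le> (C * dist s t) * W * M + U * (D * dist s t) * M"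
      using lipschitz_onD[OF C st] lipschitz_onD[OF D st] U(1) W(1) U(2)[OF st(2)] W(2)[OF st(1)] M(1) C0
      by (intro add_mono mult_right_mono mult_mono) (simp_all add: dist_norm)
    finally show "dist (pr (u s) (w s)) (pr (u t) (w t)) \<le> (C * W + U * D) * M * dist s t"
      by (simp add: dist_norm algebra_simps)
  qed (use C0 U W M in auto)
  then show ?thesis by blast
qed

lemma lipschitz_C1_Icc:
  fixes u :: "real \<Rightarrow> 'a::real_normed_vector"
  assumes "\<And>t. t \<in> {a..b} \<Longrightarrow> (u has_vector_derivative u' t) (at t within {a..b})"
    and "continuous_on {a..b} u'"
  shows "\<exists>C. C-lipschitz_on {a..b} u"
proof -
  have "bounded (u' ` {a..b})"
    by (intro compact_imp_bounded compact_continuous_image assms compact_Icc)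
  then obtain B where B: "B > 0" "\<And>t. t \<in> {a..b} \<Longrightarrow> norm (u' t) \<le> B" unfolding bounded_pos by auto
  have "B-lipschitz_on {a..b} u"
  proof (rule bounded_derivative_imp_lipschitz)
    show "(u has_derivative (\<lambda>x. x *\<^sub>R u' t)) (at t within {a..b})" if "t \<in> {a..b}" for t
      using assms(1)[OF that] by (simp add: has_vector_derivative_def)
    show "onorm (\<lambda>x. x *\<^sub>R u' t) \<le> B" if "t \<in> {a..b}" for t
      using B that by (intro onorm_le) (auto simp: mult.commute[of B] intro!: mult_left_mono)
  qed (use B in auto)
  then show ?thesis by blast
qed

section \<open>Zeros of a regularized monotone operator\<close>

text \<open>
  A function \<open>\<phi>\<close> with \<open>L\<close>-Lipschitz gradient \<open>G\<close> that lies above its tangents (that is, \<open>\<phi>\<close> is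
  convex), and a skew linear operator \<open>J\<close>.
\<close>

locale skew_gradient =
  fixes \<phi> :: "'a::euclidean_space \<Rightarrow> real" and G J :: "'a \<Rightarrow> 'a" and L :: real
  assumes grad: "GDERIV \<phi> v :> G v"
    and grad_ineq: "\<phi> v + G v \<bullet> (u - v) \<le> \<phi> u"
    and lip: "L-lipschitz_on UNIV G"
    and J_linear: "bounded_linear J"
    and skew: "J u \<bullet> u = 0"
begin

lemmas J_simps = bounded_linear.linear[OF J_linear, THEN linear_add]
  bounded_linear.linear[OF J_linear, THEN linear_diff]
  bounded_linear.linear[OF J_linear, THEN linear_scale]

lemma skew_swap: "J u \<bullet> v = - (u \<bullet> J v)"
  using skew[of "u + v"] skew[of u] skew[of v]
  by (simp add: J_simps inner_simps inner_commute)

lemma G_mono: "0 \<le> (G u - G v) \<bullet> (u - v)"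
  using grad_ineq[of u v] grad_ineq[of v u] by (simp add: inner_simps algebra_simps)

text \<open>
  The operator whose zeros are the saddle points of the Lagrangian regularized with \<open>e\<close>.
\<close>

definition F :: "real \<Rightarrow> 'a \<Rightarrow> 'a" where "F e u = G u + J u + e *\<^sub>R u"

lemma F_strong_mono: "e * (norm (u - v))\<^sup>2 \<le> (F e u - F e v) \<bullet> (u - v)"
proof -
  have "(F e u - F e v) \<bullet> (u - v) =
      (G u - G v) \<bullet> (u - v) + J (u - v) \<bullet> (u - v) + e * ((u - v) \<bullet> (u - v))"
    unfolding F_def J_simps by (simp add: inner_simps algebra_simps)
  then show ?thesis using G_mono[of u v] skew[of "u - v"] by (simp add: power2_norm_eq_inner)
qed

lemma F_zero_unique:
  assumes "e > 0" "F e u = 0" "F e v = 0"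
  shows "u = v"
  using F_strong_mono[of e u v] assms by (simp add: mult_le_0_iff)

lemma F_lipschitz:
  obtains M where "\<And>u v. norm (F e u - F e v) \<le> M * norm (u - v)" "M > \<bar>e\<bar>"
proof
  define B where "B = onorm J"
  have B: "norm (J u) \<le> B * norm u" "B \<ge> 0" for u
    using onorm[OF J_linear] onorm_pos_le[OF J_linear] by (auto simp: B_def)
  show "norm (F e u - F e v) \<le> (L + B + \<bar>e\<bar> + 1) * norm (u - v)" for u v
  proof -
    have "norm (F e u - F e v) = norm ((G u - G v) + J (u - v) + e *\<^sub>R (u - v))"
      by (simp add: F_def J_simps algebra_simps)
    also have "\<dots> \<le> norm (G u - G v) + norm (J (u - v)) + norm (e *\<^sub>R (u - v))"
      by (intro order_trans[OF norm_triangle_ineq] add_right_mono norm_triangle_ineq)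
    also have "\<dots> \<le> L * norm (u - v) + B * norm (u - v) + \<bar>e\<bar> * norm (u - v) + norm (u - v)"
      using lipschitz_onD[OF lip UNIV_I UNIV_I, of u v] B(1)[of "u - v"] norm_ge_zero[of "u - v"]
      unfolding dist_norm norm_scaleR by linarith
    finally show ?thesis by (simp add: algebra_simps)
  qed
  show "L + B + \<bar>e\<bar> + 1 > \<bar>e\<bar>" using B(2) lipschitz_on_nonneg[OF lip] by linarith
qed

text \<open>
  The step \<open>u - s F u\<close> is a contraction for \<open>s = e / M\<^sup>2\<close>, where \<open>M\<close> is a Lipschitz constant of
  \<open>F\<close>: its squared Lipschitz constant is at most \<open>1 - 2 s e + s\<^sup>2 M\<^sup>2\<close>.
\<close>

lemma F_zero_exists:
  assumes e: "e > 0"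
  shows "\<exists>u. F e u = 0"
proof -
  obtain M where M: "\<And>u v. norm (F e u - F e v) \<le> M * norm (u - v)" "M > \<bar>e\<bar>"
    using F_lipschitz by blast
  have M0: "M > 0" using M(2) by linarith
  define s where "s = e / M\<^sup>2"
  define q where "q = 1 - e\<^sup>2 / M\<^sup>2"
  have "e\<^sup>2 < M\<^sup>2" using M(2) e by (intro power_strict_mono) auto
  then have q: "0 \<le> q" "q < 1" using e M0 M(2) by (auto simp: q_def field_simps)
  define S where "S u = u - s *\<^sub>R F e u" for u
  have contr: "dist (S u) (S v) \<le> sqrt q * dist u v" for u v
  proof -
    define d where "d = u - v"
    define D where "D = F e u - F e v"
    have "(norm (S u - S v))\<^sup>2 = (norm (d - s *\<^sub>R D))\<^sup>2"
      by (simp add: S_def d_def D_def algebra_simps)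
    also have "\<dots> = (norm d)\<^sup>2 - 2 * s * (D \<bullet> d) + s\<^sup>2 * (norm D)\<^sup>2"
      unfolding power2_norm_eq_inner
      by (simp add: inner_simps inner_commute power2_eq_square algebra_simps)
    also have "\<dots> \<le> (norm d)\<^sup>2 - 2 * s * (e * (norm d)\<^sup>2) + s\<^sup>2 * (M * norm d)\<^sup>2"
      using F_strong_mono[of e u v] M(1)[of u v] e M0
      by (intro add_mono diff_mono mult_left_mono power_mono order_refl) (auto simp: d_def D_def s_def)
    also have "\<dots> = q * (norm d)\<^sup>2"
      using M0 by (simp add: q_def s_def power2_eq_square field_simps)
    finally have "norm (S u - S v) \<le> sqrt (q * (norm d)\<^sup>2)" by (simp add: real_le_rsqrt)
    then show ?thesis by (simp add: real_sqrt_mult dist_norm d_def)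
  qed
  have "\<exists>!u. S u = u"
    by (rule banach_fix_type[where c="sqrt q"]) (use q contr in auto)
  then obtain u where "S u = u" by blast
  then show ?thesis using e M0 by (auto simp: S_def s_def)
qed

lemma zero_path_norm_le:
  assumes "e > 0" "F e u = 0" "F 0 p = 0"
  shows "(norm u)\<^sup>2 \<le> u \<bullet> p" "norm u \<le> norm p"
proof -
  have "F e p = e *\<^sub>R p" using assms(3) by (simp add: F_def)
  then have "e * (norm (u - p))\<^sup>2 \<le> e * (- (p \<bullet> (u - p)))"
    using F_strong_mono[of e u p] assms(2) by simp
  then have "(norm (u - p))\<^sup>2 \<le> - (p \<bullet> (u - p))"
    using assms(1) by (simp only: mult_le_cancel_left_pos)
  then show *: "(norm u)\<^sup>2 \<le> u \<bullet> p"
    by (simp add: power2_norm_eq_inner inner_simps inner_commute)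
  have "norm u * norm u \<le> norm u * norm p"
    using * norm_cauchy_schwarz[of u p] by (simp add: power2_eq_square)
  then show "norm u \<le> norm p" by (cases "u = 0") auto
qed

lemma zero_path_lipschitz:
  assumes "e > 0" "F e u = 0" "F e' v = 0"
  shows "norm (u - v) \<le> norm v / e * \<bar>e - e'\<bar>"
proof -
  have "F e v = (e - e') *\<^sub>R v" using assms(3) by (simp add: F_def algebra_simps)
  then have "e * (norm (u - v))\<^sup>2 \<le> - (((e - e') *\<^sub>R v) \<bullet> (u - v))"
    using F_strong_mono[of e u v] assms(2) by simp
  also have "\<dots> \<le> \<bar>e - e'\<bar> * norm v * norm (u - v)"
    using Cauchy_Schwarz_ineq2[of "(e - e') *\<^sub>R v" "u - v"] by simp
  finally have "e * norm (u - v) * norm (u - v) \<le> \<bar>e - e'\<bar> * norm v * norm (u - v)"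
    by (simp add: power2_eq_square mult.assoc)
  then have "e * norm (u - v) \<le> \<bar>e - e'\<bar> * norm v" by (cases "u = v") auto
  then show ?thesis using assms(1) by (simp add: field_simps)
qed

lemma F_continuous: "continuous_on UNIV (F e)"
  unfolding F_def
  by (intro continuous_intros lipschitz_on_continuous_on[OF lip]
      linear_continuous_on J_linear)

text \<open>
  A limit \<open>w\<close> of zeros of \<open>F e\<close> with \<open>e\<close> tending to \<open>0\<close> is a zero of \<open>F 0\<close> with
  \<open>|w|\<^sup>2 \<le> w \<bullet> p\<close>. As \<open>p\<close> has least norm, this forces \<open>w = p\<close>.
\<close>

lemma zero_path_limit:
  assumes p: "F 0 p = 0" and min: "\<And>w. F 0 w = 0 \<Longrightarrow> norm p \<le> norm w" and "\<delta> > 0"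
  shows "\<exists>e0>0. \<forall>e u. 0 < e \<and> e < e0 \<and> F e u = 0 \<longrightarrow> dist u p < \<delta>"
proof (rule ccontr)
  assume "\<not> ?thesis"
  then have "\<forall>n. \<exists>e u. 0 < e \<and> e < inverse (real (Suc n)) \<and> F e u = 0 \<and> \<delta> \<le> dist u p"
    by (metis inverse_positive_iff_positive of_nat_0_less_iff zero_less_Suc linorder_not_less)
  then obtain e u where eu: "\<And>n. 0 < e n" "\<And>n. e n < inverse (real (Suc n))"
      "\<And>n. F (e n) (u n) = 0" "\<And>n. \<delta> \<le> dist (u n) p" by metis
  have "bounded (range u)"
    using zero_path_norm_le(2)[OF eu(1) eu(3) p] by (auto simp: bounded_iff)
  then obtain w r where r: "strict_mono (r :: nat \<Rightarrow> nat)" "(u \<circ> r) \<longlonglongrightarrow> w"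
    using bounded_imp_convergent_subsequence by metis
  have ur: "(\<lambda>n. u (r n)) \<longlonglongrightarrow> w" using r(2) by (simp add: o_def)
  have "e \<longlonglongrightarrow> 0"
    by (rule real_tendsto_sandwich[OF _ _ tendsto_const LIMSEQ_inverse_real_of_nat])
      (use eu(1,2) in \<open>auto intro!: always_eventually less_imp_le simp del: of_nat_Suc\<close>)
  then have er: "(\<lambda>n. e (r n)) \<longlonglongrightarrow> 0" using LIMSEQ_subseq_LIMSEQ[OF _ r(1)] by (simp add: o_def)
  have "(\<lambda>n. F 0 (u (r n))) \<longlonglongrightarrow> F 0 w"
    using continuous_on_tendsto_compose[OF F_continuous ur] by simp
  moreover have "F 0 (u (r n)) = - (e (r n) *\<^sub>R u (r n))" for n
    using eu(3)[of "r n"] by (simp add: F_def eq_neg_iff_add_eq_0)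
  moreover have "(\<lambda>n. - (e (r n) *\<^sub>R u (r n))) \<longlonglongrightarrow> - (0 *\<^sub>R w)"
    by (intro tendsto_intros er ur)
  ultimately have "F 0 w = 0" using LIMSEQ_unique by fastforce
  then have "norm p \<le> norm w" by (rule min)
  have "(norm w)\<^sup>2 \<le> w \<bullet> p"
    by (rule LIMSEQ_le[where X="\<lambda>n. (norm (u (r n)))\<^sup>2" and Y="\<lambda>n. u (r n) \<bullet> p"])
      (auto intro!: tendsto_intros ur zero_path_norm_le(1)[OF eu(1) eu(3) p])
  moreover have "(norm p)\<^sup>2 \<le> (norm w)\<^sup>2" using \<open>norm p \<le> norm w\<close> by (intro power_mono) auto
  ultimately have "(norm (w - p))\<^sup>2 \<le> 0"
    by (simp add: power2_norm_eq_inner inner_simps inner_commute)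
  then have "w = p" by simp
  moreover have "\<delta> \<le> dist w p"
    by (rule LIMSEQ_le_const[where X="\<lambda>n. dist (u (r n)) p"]) (auto intro!: tendsto_intros ur eu)
  ultimately show False using \<open>\<delta> > 0\<close> by simp
qed

end

section \<open>Dissipation of the energy\<close>

lemma square_completion:
  fixes p d :: "'a::real_inner" and c :: real
  assumes "c > 0"
  shows "- (c / 2) * (norm d)\<^sup>2 - p \<bullet> d \<le> (norm p)\<^sup>2 / (2 * c)"
proof -
  have "0 \<le> (norm (p + c *\<^sub>R d))\<^sup>2" by simp
  also have "\<dots> = (norm p)\<^sup>2 + 2 * c * (p \<bullet> d) + c\<^sup>2 * (norm d)\<^sup>2"
    unfolding power2_norm_eq_inner by (simp add: inner_simps inner_commute power2_eq_square algebra_simps)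
  finally show ?thesis using assms by (simp add: field_simps power2_eq_square)
qed

context skew_gradient
begin

text \<open>
  The primal-dual gap of \<open>u\<close> relative to the saddle point \<open>s\<close> of the Lagrangian \<open>M\<close> regularized
  with \<open>e\<close>: for \<open>u = (x, y)\<close> and \<open>s = (a, b)\<close> it is \<open>M x b - M a y\<close>.
\<close>

definition gap :: "real \<Rightarrow> 'a \<Rightarrow> 'a \<Rightarrow> real" where
  "gap e s u = \<phi> u - \<phi> s + e / 2 * ((norm u)\<^sup>2 - (norm s)\<^sup>2) + J s \<bullet> u"

lemma gap_lower:
  assumes "F e s = 0"
  shows "e / 2 * (norm (u - s))\<^sup>2 \<le> gap e s u"
proof -
  have Gs: "G s = - J s - e *\<^sub>R s" using assms by (simp add: F_def algebra_simps eq_neg_iff_add_eq_0)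
  have "G s \<bullet> (u - s) = - (J s \<bullet> u) - e * (s \<bullet> (u - s))"
    unfolding Gs using skew[of s] by (simp add: inner_simps right_diff_distrib)
  then have "\<phi> s - J s \<bullet> u - e * (s \<bullet> (u - s)) \<le> \<phi> u"
    using grad_ineq[of s u] by linarith
  then show ?thesis
    unfolding gap_def power2_norm_eq_inner by (simp add: inner_simps inner_commute field_simps)
qed

lemma gap_upper:
  "gap e s u + e / 2 * (norm (u - s))\<^sup>2 \<le> (u - s) \<bullet> (G u + e *\<^sub>R u) + J s \<bullet> u"
  using grad_ineq[of u s] unfolding gap_def power2_norm_eq_inner
  by (simp add: inner_simps inner_commute field_simps)

text \<open>
  The pairing of \<open>w = z - s + \<theta> t v\<close> with its time derivative along the flow, in which \<open>ds\<close> is the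
  velocity of \<open>s\<close>. By skewness \<open>J\<close> enters only through \<open>J s\<close>.
\<close>

lemma velocity_pairing:
  fixes z v s ds :: 'a and t \<theta> a b e :: real
  defines "\<eta> \<equiv> \<theta> * t * a - 1 - \<theta>"
  shows "(z - s + (\<theta> * t) *\<^sub>R v) \<bullet>
      (v - ds + \<theta> *\<^sub>R v + (\<theta> * t) *\<^sub>R (- (a *\<^sub>R v) - b *\<^sub>R (G z + e *\<^sub>R z + J (z + (\<theta> * t) *\<^sub>R v)))) =
    - \<eta> * ((z - s) \<bullet> v) - (z - s) \<bullet> ds - \<theta> * t * \<eta> * (v \<bullet> v) - \<theta> * t * (v \<bullet> ds)
    - \<theta> * t * b * ((z - s) \<bullet> (G z + e *\<^sub>R z) + J s \<bullet> z
        + \<theta> * t * (v \<bullet> (G z + e *\<^sub>R z) + J s \<bullet> v))" (is "?l = ?r")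
proof -
  define d where "d = z - s"
  define g where "g = G z + e *\<^sub>R z"
  define k where "k = \<theta> * t"
  have 1: "d \<bullet> J z = J s \<bullet> z" using skew[of z] skew_swap[of s z]
    by (simp add: d_def inner_simps inner_commute)
  have 2: "d \<bullet> J v + v \<bullet> J z = J s \<bullet> v" using skew_swap[of s v] skew_swap[of z v]
    by (simp add: d_def inner_simps inner_commute)
  have 3: "v \<bullet> J v = 0" using skew[of v] by (simp add: inner_commute)
  have "?l = (d + k *\<^sub>R v) \<bullet> (- (\<eta> *\<^sub>R v) - ds - (k * b) *\<^sub>R (g + J z + k *\<^sub>R J v))"
    unfolding d_def g_def k_def \<eta>_def J_simps by (simp add: algebra_simps)
  also have "\<dots> = - \<eta> * (d \<bullet> v) - d \<bullet> ds - k * \<eta> * (v \<bullet> v) - k * (v \<bullet> ds)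
      - k * b * (d \<bullet> g + d \<bullet> J z + k * (d \<bullet> J v + v \<bullet> J z) + k * (v \<bullet> g) + k\<^sup>2 * (v \<bullet> J v))"
    by (simp add: inner_simps power2_eq_square algebra_simps)
  also have "\<dots> = ?r" unfolding 1 2 3 by (simp add: d_def g_def k_def algebra_simps)
  finally show ?thesis .
qed

text \<open>
  The left-hand side is the time derivative of the energy (see \<open>energy_has_derivative\<close>), written
  with the values at one time of the coefficients, of their derivatives \<open>a'\<close>, \<open>b'\<close>, \<open>e'\<close>, and of
  the velocity \<open>ds\<close> of \<open>s\<close>. The coefficient of \<open>(norm (z - s))\<^sup>2\<close> that remains
  is \<open>- \<theta>\<^sup>2 t\<^sup>2 l / 2\<close>, that of \<open>v \<bullet> v\<close> is \<open>- \<theta>\<^sup>2 t\<^sup>2 \<Gamma>\<close>, and all terms with \<open>ds\<close> or \<open>e'\<close> are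
  collected in \<open>P\<close>, except \<open>v \<bullet> ds\<close> and a multiple of \<open>e' (norm (z - s))\<^sup>2\<close>, which is nonpositive.
\<close>

lemma energy_dissipation:
  fixes z v s ds :: 'a and t \<theta> a a' b b' e e' :: real
  defines "\<eta> \<equiv> \<theta> * t * a - 1 - \<theta>"
  defines "l \<equiv> 1 / (\<theta> * t) * (b * e - a' - a / t)"
  defines "\<Gamma> \<equiv> a - (1 + \<theta>) / (\<theta> * t)"
  defines "P \<equiv> - (b *\<^sub>R J ds) - (b * e') *\<^sub>R s + ((a - 1 / t) / (\<theta> * t)) *\<^sub>R ds"
  assumes s: "F e s = 0" and pos: "t > 0" "\<theta> > 0" "b > 0" "e > 0" "l > 0" "\<Gamma> > 0"
    and e': "e' \<le> 0" and b': "(2 * \<theta> - 1) * b + \<theta> * t * b' \<le> 0"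
  shows "\<theta>\<^sup>2 * (2 * t * b + t\<^sup>2 * b') * gap e s z
     + \<theta>\<^sup>2 * t\<^sup>2 * b * ((G z + e *\<^sub>R z + J s) \<bullet> v + J ds \<bullet> (z - s) + e' / 2 * ((norm z)\<^sup>2 - (norm s)\<^sup>2))
     + (z - s + (\<theta> * t) *\<^sub>R v) \<bullet>
       (v - ds + \<theta> *\<^sub>R v + (\<theta> * t) *\<^sub>R (- (a *\<^sub>R v) - b *\<^sub>R (G z + e *\<^sub>R z + J (z + (\<theta> * t) *\<^sub>R v))))
     + (\<theta> * a + \<theta> * t * a') / 2 * (norm (z - s))\<^sup>2 + \<eta> * ((z - s) \<bullet> (v - ds))
    \<le> \<theta>\<^sup>2 * t\<^sup>2 / 2 * ((norm P)\<^sup>2 / l + (norm ds)\<^sup>2 / (2 * \<theta>\<^sup>2 * t\<^sup>2 * \<Gamma>))" (is "?l \<le> ?r")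
proof -
  define d where "d = z - s"
  define n where "n = (norm d)\<^sup>2"
  define D where "D = gap e s z"
  define X where "X = d \<bullet> (G z + e *\<^sub>R z) + J s \<bullet> z"
  define k where "k = \<theta> * t"
  have k: "k > 0" using pos by (simp add: k_def)
  have n0: "n \<ge> 0" by (simp add: n_def)
  have D: "e / 2 * n \<le> D" unfolding n_def d_def D_def by (rule gap_lower[OF s])
  have D0: "D \<ge> 0" using D n0 pos by (meson divide_nonneg_pos mult_nonneg_nonneg order.trans less_imp_le zero_less_numeral)
  have X: "D + e / 2 * n \<le> X" unfolding n_def d_def D_def X_def by (rule gap_upper)
  have ns: "(norm z)\<^sup>2 - (norm s)\<^sup>2 = n + 2 * (s \<bullet> d)"
    unfolding n_def d_def power2_norm_eq_inner by (simp add: inner_simps inner_commute)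
  have \<eta>: "\<eta> = k * k * \<Gamma> / k" using pos by (simp add: \<eta>_def \<Gamma>_def k_def field_simps)
  have \<eta>1: "1 + \<eta> = k * k * ((a - 1 / t) / (\<theta> * t))" using pos by (simp add: \<eta>_def k_def field_simps)
  have l: "k * k * l = k * b * e - (\<theta> * a + \<theta> * t * a')" using pos by (simp add: l_def k_def field_simps)
  have "?l = k * (\<theta> * (2 * b + t * b')) * D
      + k * k * b * ((G z + e *\<^sub>R z + J s) \<bullet> v + J ds \<bullet> d + e' / 2 * (n + 2 * (s \<bullet> d)))
      + (- \<eta> * (d \<bullet> v) - d \<bullet> ds - k * \<eta> * (v \<bullet> v) - k * (v \<bullet> ds)
         - k * b * (X + k * (v \<bullet> (G z + e *\<^sub>R z) + J s \<bullet> v)))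
      + (\<theta> * a + \<theta> * t * a') / 2 * n + \<eta> * (d \<bullet> (v - ds))"
    unfolding velocity_pairing ns \<eta>_def
    by (simp add: d_def n_def D_def X_def k_def power2_eq_square algebra_simps)
  also have "\<dots> = k * ((2 * \<theta> - 1) * b + \<theta> * t * b') * D + k * b * (D - X)
      + k * k * b * (J ds \<bullet> d) + k * k * b * (e' / 2 * n) + k * k * (b * e') * (s \<bullet> d)
      - (1 + \<eta>) * (d \<bullet> ds) - k * \<eta> * (v \<bullet> v) - k * (v \<bullet> ds) + (\<theta> * a + \<theta> * t * a') / 2 * n"
    by (simp add: inner_simps inner_commute algebra_simps)
  also have "\<dots> \<le> 0 + k * b * (- (e / 2 * n)) + k * k * b * (J ds \<bullet> d) + 0 + k * k * (b * e') * (s \<bullet> d)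
      - (1 + \<eta>) * (d \<bullet> ds) - k * \<eta> * (v \<bullet> v) - k * (v \<bullet> ds) + (\<theta> * a + \<theta> * t * a') / 2 * n"
  proof -
    have "k * ((2 * \<theta> - 1) * b + \<theta> * t * b') * D \<le> 0"
      using k D0 b' by (simp add: mult_nonneg_nonpos mult_nonpos_nonneg)
    moreover have "k * b * (D - X) \<le> k * b * (- (e / 2 * n))"
      using X k pos by (intro mult_left_mono) auto
    moreover have "k * k * b * (e' / 2 * n) \<le> 0"
      using e' n0 k pos by (intro mult_nonneg_nonpos mult_nonpos_nonneg) auto
    ultimately show ?thesis by linarith
  qed
  also have "\<dots> = k * k * (- (l / 2) * n - P \<bullet> d) + k * k * (- \<Gamma> * (v \<bullet> v) - (v \<bullet> ds) / k)"
  proof -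
    have "k * k * (P \<bullet> d) = - (k * k * b * (J ds \<bullet> d)) - k * k * (b * e') * (s \<bullet> d) + (1 + \<eta>) * (d \<bullet> ds)"
      unfolding P_def \<eta>1 by (simp add: inner_simps inner_commute algebra_simps)
    moreover have "k * k * (l / 2 * n) = k * b * (e / 2 * n) - (\<theta> * a + \<theta> * t * a') / 2 * n"
    proof -
      have "k * k * (l / 2 * n) = (k * b * e - (\<theta> * a + \<theta> * t * a')) / 2 * n"
        unfolding l[symmetric] by simp
      then show ?thesis by (simp add: diff_divide_distrib left_diff_distrib)
    qed
    moreover have "k * k * (\<Gamma> * (v \<bullet> v)) = k * \<eta> * (v \<bullet> v)" "k * k * ((v \<bullet> ds) / k) = k * (v \<bullet> ds)"
      unfolding \<eta> using k by simp_all
    moreover have "k * k * (- (l / 2) * n - P \<bullet> d) = - (k * k * (l / 2 * n)) - k * k * (P \<bullet> d)"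
      "k * k * (- \<Gamma> * (v \<bullet> v) - (v \<bullet> ds) / k) =
        - (k * k * (\<Gamma> * (v \<bullet> v))) - k * k * ((v \<bullet> ds) / k)"
      by (simp_all only: right_diff_distrib mult_minus_left mult_minus_right divide_minus_left minus_divide_left[symmetric])
    moreover have
      "k * b * (- (e / 2 * n)) = - (k * b * (e / 2 * n))"
      by simp
    ultimately show ?thesis by linarith
  qed
  also have "\<dots> \<le> k * k * ((norm P)\<^sup>2 / (2 * l)) + k * k * ((norm (ds /\<^sub>R k))\<^sup>2 / (2 * (2 * \<Gamma>)))"
  proof (intro add_mono mult_left_mono)
    show "- (l / 2) * n - P \<bullet> d \<le> (norm P)\<^sup>2 / (2 * l)"
      unfolding n_def by (rule square_completion) (rule pos)
    show "- \<Gamma> * (v \<bullet> v) - (v \<bullet> ds) / k \<le> (norm (ds /\<^sub>R k))\<^sup>2 / (2 * (2 * \<Gamma>))"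
    proof -
      have "(ds /\<^sub>R k) \<bullet> v = (v \<bullet> ds) / k" by (simp add: inner_commute divide_inverse)
      then show ?thesis
        using square_completion[of "2 * \<Gamma>" v "ds /\<^sub>R k"] pos
        by (simp only: power2_norm_eq_inner[of v]) simp
    qed
  qed (use k in auto)
  also have "\<dots> = ?r"
    using k pos unfolding k_def
    by (simp add: power2_eq_square field_simps)
  finally show ?thesis .
qed

end

context skew_gradient
begin

lemma G_continuous: "continuous_on S G"
  using lipschitz_on_continuous_on[OF lip] continuous_on_subset by blast

lemma potential_lipschitz_Icc:
  fixes u :: "real \<Rightarrow> 'a"
  assumes "\<exists>C. C-lipschitz_on {a..b} u"
  shows "\<exists>C. C-lipschitz_on {a..b} (\<lambda>t. \<phi> (u t))"
proof -
  obtain C where C: "C-lipschitz_on {a..b} u" using assms by auto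
  obtain U where U: "U > 0" "\<And>t. t \<in> {a..b} \<Longrightarrow> norm (u t) \<le> U"
    by (rule lipschitz_Icc_bounded[OF C]) blast
  have "bounded (G ` cball 0 U)"
    by (intro compact_imp_bounded compact_continuous_image G_continuous compact_cball)
  then obtain B where B: "B > 0" "\<And>w. w \<in> cball 0 U \<Longrightarrow> norm (G w) \<le> B" unfolding bounded_pos by auto
  have "B-lipschitz_on (cball 0 U) \<phi>"
  proof (rule bounded_derivative_imp_lipschitz)
    show "(\<phi> has_derivative (\<lambda>h. h \<bullet> G w)) (at w within cball 0 U)" for w
      using grad[of w] unfolding gderiv_def by (rule has_derivative_at_withinI)
    show "onorm (\<lambda>h. h \<bullet> G w) \<le> B" if "w \<in> cball 0 U" for w
    proof (rule onorm_le)
      fix h show "norm (h \<bullet> G w) \<le> B * norm h"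
        using Cauchy_Schwarz_ineq2[of h "G w"] mult_left_mono[OF B(2)[OF that], of "norm h"]
        by (simp add: mult.commute)
    qed
  qed (use B in auto)
  then have "B-lipschitz_on (u ` {a..b}) \<phi>" by (rule lipschitz_on_subset) (use U(2) in auto)
  from lipschitz_on_compose2[OF C this] show ?thesis by blast
qed

text \<open>
  The Lyapunov function, as a function of time \<open>t\<close>, along a curve \<open>z\<close> with velocity \<open>v\<close> and a moving
  saddle point \<open>s\<close>.
\<close>

definition energy ::
  "real \<Rightarrow> (real \<Rightarrow> real) \<Rightarrow> (real \<Rightarrow> real) \<Rightarrow> (real \<Rightarrow> real) \<Rightarrow> (real \<Rightarrow> 'a) \<Rightarrow> (real \<Rightarrow> 'a) \<Rightarrow> (real \<Rightarrow> 'a) \<Rightarrow> real \<Rightarrow> real"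
  where "energy \<theta> \<alpha> \<beta> \<epsilon> z v s t =
    \<theta>\<^sup>2 * t\<^sup>2 * \<beta> t * gap (\<epsilon> t) (s t) (z t)
    + (norm (z t - s t + (\<theta> * t) *\<^sub>R v t))\<^sup>2 / 2
    + (\<theta> * t * \<alpha> t - 1 - \<theta>) / 2 * (norm (z t - s t))\<^sup>2"

lemma energy_lipschitz:
  assumes "\<exists>C. C-lipschitz_on {a..b} \<alpha>" "\<exists>C. C-lipschitz_on {a..b} \<beta>" "\<exists>C. C-lipschitz_on {a..b} \<epsilon>"
    "\<exists>C. C-lipschitz_on {a..b} z" "\<exists>C. C-lipschitz_on {a..b} v" "\<exists>C. C-lipschitz_on {a..b} s"
  shows "\<exists>C. C-lipschitz_on {a..b} (energy \<theta> \<alpha> \<beta> \<epsilon> z v s)"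
proof -
  note mult = lipschitz_bilinear_Icc[OF bounded_bilinear_mult]
  note inner = lipschitz_bilinear_Icc[OF bounded_bilinear_inner]
  note scale = lipschitz_bilinear_Icc[OF bounded_bilinear_scaleR]
  have const: "\<exists>C. C-lipschitz_on {a..b} (\<lambda>t::real. c)" for c :: "'z::metric_space"
    using lipschitz_on_constant by blast
  have id: "\<exists>C. C-lipschitz_on {a..b} (\<lambda>t::real. t)" using lipschitz_on_id by blast
  have add: "\<exists>C. C-lipschitz_on {a..b} (\<lambda>t. f t + g t)"
    if "\<exists>C. C-lipschitz_on {a..b} f" "\<exists>C. C-lipschitz_on {a..b} g" for f g :: "real \<Rightarrow> 'z::real_normed_vector"
    using that lipschitz_on_add by blast
  have diff: "\<exists>C. C-lipschitz_on {a..b} (\<lambda>t. f t - g t)"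
    if "\<exists>C. C-lipschitz_on {a..b} f" "\<exists>C. C-lipschitz_on {a..b} g" for f g :: "real \<Rightarrow> 'z::real_normed_vector"
    using that lipschitz_on_diff by blast
  have J: "\<exists>C. C-lipschitz_on {a..b} (\<lambda>t. J (f t))" if "\<exists>C. C-lipschitz_on {a..b} f" for f
  proof -
    obtain k where k: "k > 0" "\<And>x. norm (J x) \<le> norm x * k"
      using bounded_linear.pos_bounded[OF J_linear] by blast
    have "k-lipschitz_on (f ` {a..b}) J"
      by (rule lipschitz_onI) (use k(1) k(2)[of "x - y" for x y] in \<open>auto simp: dist_norm J_simps mult.commute\<close>)
    then show ?thesis using that lipschitz_on_compose2 by blast
  qed
  show ?thesis
    unfolding energy_def gap_def power2_norm_eq_inner unfolding power2_eq_square divide_inverse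
    by (intro add diff mult inner scale J potential_lipschitz_Icc const id assms)
qed

lemma potential_has_derivative:
  assumes "(z has_vector_derivative v) (at t)"
  shows "((\<lambda>t. \<phi> (z t)) has_real_derivative (G (z t) \<bullet> v)) (at t)"
proof -
  have "((\<lambda>t. \<phi> (z t)) has_derivative (\<lambda>h. (h *\<^sub>R v) \<bullet> G (z t))) (at t)"
    using assms grad[of "z t"] unfolding gderiv_def has_vector_derivative_def
    by (rule has_derivative_compose)
  then show ?thesis
    unfolding has_field_derivative_def by (simp add: inner_commute mult_commute_abs)
qed

lemma energy_has_derivative:
  assumes \<alpha>: "(\<alpha> has_real_derivative a') (at t)" and \<beta>: "(\<beta> has_real_derivative b') (at t)"
    and \<epsilon>: "(\<epsilon> has_real_derivative e') (at t)"
    and z: "(z has_vector_derivative v t) (at t)" and v: "(v has_vector_derivative v') (at t)"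
    and s: "(s has_vector_derivative ds) (at t)" and zero: "F (\<epsilon> t) (s t) = 0"
  shows "(energy \<theta> \<alpha> \<beta> \<epsilon> z v s has_real_derivative
    \<theta>\<^sup>2 * (2 * t * \<beta> t + t\<^sup>2 * b') * gap (\<epsilon> t) (s t) (z t)
     + \<theta>\<^sup>2 * t\<^sup>2 * \<beta> t * ((G (z t) + \<epsilon> t *\<^sub>R z t + J (s t)) \<bullet> v t + J ds \<bullet> (z t - s t)
         + e' / 2 * ((norm (z t))\<^sup>2 - (norm (s t))\<^sup>2))
     + (z t - s t + (\<theta> * t) *\<^sub>R v t) \<bullet> (v t - ds + \<theta> *\<^sub>R v t + (\<theta> * t) *\<^sub>R v')
     + (\<theta> * \<alpha> t + \<theta> * t * a') / 2 * (norm (z t - s t))\<^sup>2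
     + (\<theta> * t * \<alpha> t - 1 - \<theta>) * ((z t - s t) \<bullet> (v t - ds))) (at t)"
proof -
  have inner: "((\<lambda>t. p t \<bullet> q t) has_real_derivative (p t \<bullet> q' + p' \<bullet> q t)) (at t)"
    if "(p has_vector_derivative p') (at t)" "(q has_vector_derivative q') (at t)" for p q :: "real \<Rightarrow> 'a" and p' q'
    using bounded_bilinear.has_vector_derivative[OF bounded_bilinear_inner that]
    by (simp add: has_real_derivative_iff_has_vector_derivative)
  have sq: "((\<lambda>t. (norm (p t))\<^sup>2) has_real_derivative (2 * (p t \<bullet> p'))) (at t)"
    if "(p has_vector_derivative p') (at t)" for p :: "real \<Rightarrow> 'a" and p'
    using inner[OF that that] unfolding power2_norm_eq_inner by (simp add: inner_commute)
  have d: "((\<lambda>t. z t - s t) has_vector_derivative (v t - ds)) (at t)"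
    by (rule has_vector_derivative_diff[OF z s])
  have \<theta>t: "((\<lambda>t. \<theta> * t) has_real_derivative \<theta>) (at t)" by (auto intro!: derivative_eq_intros)
  have w: "((\<lambda>t. z t - s t + (\<theta> * t) *\<^sub>R v t) has_vector_derivative
      (v t - ds + \<theta> *\<^sub>R v t + (\<theta> * t) *\<^sub>R v')) (at t)"
    using has_vector_derivative_add[OF d has_vector_derivative_scaleR[OF \<theta>t v]]
    by (simp add: algebra_simps)
  have Js: "((\<lambda>t. J (s t)) has_vector_derivative J ds) (at t)"
    by (rule bounded_linear.has_vector_derivative[OF J_linear s])
  have gap: "((\<lambda>t. gap (\<epsilon> t) (s t) (z t)) has_real_derivative
      ((G (z t) + \<epsilon> t *\<^sub>R z t + J (s t)) \<bullet> v t + J ds \<bullet> (z t - s t)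
         + e' / 2 * ((norm (z t))\<^sup>2 - (norm (s t))\<^sup>2))) (at t)"
  proof -
    have D: "((\<lambda>t. gap (\<epsilon> t) (s t) (z t)) has_real_derivative
      (G (z t) \<bullet> v t - G (s t) \<bullet> ds
        + (\<epsilon> t / 2 * (2 * (z t \<bullet> v t) - 2 * (s t \<bullet> ds)) + e' / 2 * ((norm (z t))\<^sup>2 - (norm (s t))\<^sup>2))
        + (J (s t) \<bullet> v t + J ds \<bullet> z t))) (at t)"
      unfolding gap_def
      by (intro DERIV_add DERIV_diff potential_has_derivative z s inner Js DERIV_mult' DERIV_cdivide sq \<epsilon>)
    have "G (s t) \<bullet> ds + \<epsilon> t * (s t \<bullet> ds) = - (J (s t) \<bullet> ds)"
    proof -
      have "F (\<epsilon> t) (s t) \<bullet> ds = 0" using zero by simp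
      then show ?thesis by (simp add: F_def inner_simps)
    qed
    moreover have "J (s t) \<bullet> ds = - (J ds \<bullet> s t)" using skew_swap[of "s t" ds] by (simp add: inner_commute)
    ultimately show ?thesis
      by (intro DERIV_cong[OF D]) (simp add: inner_simps field_simps)
  qed
  have c: "((\<lambda>t. \<theta>\<^sup>2 * t\<^sup>2 * \<beta> t) has_real_derivative \<theta>\<^sup>2 * (2 * t * \<beta> t + t\<^sup>2 * b')) (at t)"
    by (auto intro!: derivative_eq_intros \<beta> simp: algebra_simps)
  have \<eta>: "((\<lambda>t. (\<theta> * t * \<alpha> t - 1 - \<theta>) / 2) has_real_derivative (\<theta> * \<alpha> t + \<theta> * t * a') / 2) (at t)"
    by (auto intro!: derivative_eq_intros \<alpha> simp: algebra_simps)
  show ?thesis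
    unfolding energy_def
    by (rule DERIV_cong[OF DERIV_add[OF DERIV_add[OF DERIV_mult'[OF c gap] DERIV_cdivide[OF sq[OF w], of 2]]
          DERIV_mult'[OF \<eta> sq[OF d]]]])
      simp
qed

end

section \<open>Convergence of trajectories\<close>

lemma C1_from_has_derivative_at:
  assumes "C1_from a h h'" "a < t"
  shows "(h has_real_derivative h' t) (at t)"
proof -
  have "(h has_real_derivative h' t) (at t within {a..})"
    using assms unfolding C1_from_def by simp
  moreover have "at t within {a..} = at t"
    using assms(2) by (intro at_within_interior) simp
  ultimately show ?thesis by simp
qed

lemma C1_from_has_derivative_within:
  assumes "C1_from a h h'" "S \<subseteq> {a..}" "t \<in> S"
  shows "(h has_real_derivative h' t) (at t within S)"
proof -
  have "(h has_real_derivative h' t) (at t within {a..})"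
    using assms unfolding C1_from_def by blast
  then show ?thesis by (rule DERIV_subset) (rule assms)
qed

lemma C1_from_continuous_on:
  assumes "C1_from a h h'" "S \<subseteq> {a..}"
  shows "continuous_on S h" "continuous_on S h'"
proof -
  show "continuous_on S h"
    using C1_from_has_derivative_within[OF assms] by (rule DERIV_continuous_on)
  show "continuous_on S h'"
    using assms unfolding C1_from_def by (blast intro: continuous_on_subset)
qed

lemma C1_from_lipschitz_Icc:
  assumes "C1_from a h h'"
  shows "\<exists>C. C-lipschitz_on {a..b} h"
proof (rule lipschitz_C1_Icc)
  have sub: "{a..b} \<subseteq> {a..}" by auto
  show "(h has_vector_derivative h' t) (at t within {a..b})" if "t \<in> {a..b}" for t
    using C1_from_has_derivative_within[OF assms sub that]
    by (simp add: has_real_derivative_iff_has_vector_derivative)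
  show "continuous_on {a..b} h'" by (rule C1_from_continuous_on[OF assms sub])
qed

text \<open>
  A solution \<open>z\<close> of the system with velocity \<open>v\<close>, the path \<open>s\<close> of zeros of \<open>F (\<epsilon> t)\<close>, and the
  zero \<open>p\<close> of \<open>F 0\<close> of least norm. The system holds at every time, since its right-hand side is
  continuous. The function \<open>ds\<close> is the velocity of \<open>s\<close> wherever this exists and is arbitrary elsewhere.
\<close>

locale gtrd_trajectory = skew_gradient \<phi> G J L
  for \<phi> :: "'a::euclidean_space \<Rightarrow> real" and G J L +
  fixes t0 \<theta> :: real and \<alpha> \<alpha>' \<beta> \<beta>' \<epsilon> \<epsilon>' :: "real \<Rightarrow> real" and z v s ds :: "real \<Rightarrow> 'a" and p :: 'a
  assumes t0: "t0 \<ge> 1" and \<theta>: "\<theta> > 0"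
    and \<alpha>: "C1_from t0 \<alpha> \<alpha>'" and \<beta>: "C1_from t0 \<beta> \<beta>'" and \<epsilon>: "C1_from t0 \<epsilon> \<epsilon>'"
    and \<beta>_pos: "t \<ge> t0 \<Longrightarrow> \<beta> t > 0" and \<epsilon>_pos: "t \<ge> t0 \<Longrightarrow> \<epsilon> t > 0"
    and \<epsilon>_antimono: "antimono_on {t0..} \<epsilon>"
    and damping: "t \<ge> t0 \<Longrightarrow> 1 + \<theta> - \<theta> * t * \<alpha> t < 0"
    and scaling: "t \<ge> t0 \<Longrightarrow> (2 * \<theta> - 1) * \<beta> t + \<theta> * t * \<beta>' t \<le> 0"
    and regularization: "t \<ge> t0 \<Longrightarrow> \<alpha> t + t * \<alpha>' t < t * \<beta> t * \<epsilon> t"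
    and zero: "t \<ge> t0 \<Longrightarrow> F (\<epsilon> t) (s t) = 0"
    and p_zero: "F 0 p = 0" and p_min: "F 0 w = 0 \<Longrightarrow> norm p \<le> norm w"
    and z_deriv: "t \<ge> t0 \<Longrightarrow> (z has_vector_derivative v t) (at t within {t0..})"
    and v_deriv: "t \<ge> t0 \<Longrightarrow> (v has_vector_derivative
      - (\<alpha> t *\<^sub>R v t) - \<beta> t *\<^sub>R (G (z t) + \<epsilon> t *\<^sub>R z t + J (z t + (\<theta> * t) *\<^sub>R v t))) (at t within {t0..})"
    and s_deriv: "t > t0 \<Longrightarrow> (s has_vector_derivative D) (at t) \<Longrightarrow> ds t = D"
begin

text \<open>
  The functions \<open>l\<close>, \<open>\<Gamma>\<close>, \<open>P\<close> and \<open>R\<close> of the theorem; in \<open>P\<close> and \<open>R\<close> the velocity \<open>u\<close> of \<open>s\<close> is an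
  argument, so that continuity in \<open>(t, u)\<close> can be used.
\<close>

definition l :: "real \<Rightarrow> real" where
  "l t = 1 / (\<theta> * t) * (\<beta> t * \<epsilon> t - \<alpha>' t - \<alpha> t / t)"

definition \<Gamma> :: "real \<Rightarrow> real" where
  "\<Gamma> t = \<alpha> t - (1 + \<theta>) / (\<theta> * t)"

definition P :: "real \<Rightarrow> 'a \<Rightarrow> 'a" where
  "P t u = - (\<beta> t *\<^sub>R J u) - (\<beta> t * \<epsilon>' t) *\<^sub>R s t + ((\<alpha> t - 1 / t) / (\<theta> * t)) *\<^sub>R u"

definition R :: "real \<Rightarrow> 'a \<Rightarrow> real" where
  "R t u = (norm (P t u))\<^sup>2 / l t + (norm u)\<^sup>2 / (2 * \<theta>\<^sup>2 * t\<^sup>2 * \<Gamma> t)"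

lemma l_pos: "t \<ge> t0 \<Longrightarrow> l t > 0"
  using regularization[of t] t0 \<theta> by (auto simp: l_def field_simps)

lemma \<Gamma>_pos: "t \<ge> t0 \<Longrightarrow> \<Gamma> t > 0"
  using damping[of t] t0 \<theta> by (auto simp: \<Gamma>_def field_simps)

lemma \<epsilon>'_nonpos:
  assumes "t > t0"
  shows "\<epsilon>' t \<le> 0"
proof -
  have "mono_on {t0..} (\<lambda>t. - \<epsilon> t)" using \<epsilon>_antimono by (auto simp: monotone_on_def)
  moreover have "((\<lambda>t. - \<epsilon> t) has_real_derivative - \<epsilon>' t) (at t)"
    by (intro DERIV_minus C1_from_has_derivative_at[OF \<epsilon>] assms)
  ultimately have "- \<epsilon>' t \<ge> 0"
    by (rule mono_on_imp_deriv_nonneg) (use assms in auto)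
  then show ?thesis by simp
qed

lemma saddle_path_lipschitz:
  assumes "b \<ge> t0"
  shows "\<exists>C. C-lipschitz_on {t0..b} s"
proof -
  obtain C where C: "C-lipschitz_on {t0..b} \<epsilon>" using C1_from_lipschitz_Icc[OF \<epsilon>] by blast
  have C0: "C \<ge> 0" using C lipschitz_on_nonneg by blast
  have "(norm p / \<epsilon> b * C)-lipschitz_on {t0..b} s"
  proof (rule lipschitz_onI)
    fix r t assume rt: "r \<in> {t0..b}" "t \<in> {t0..b}"
    then have b: "b \<ge> t0" "\<epsilon> b \<le> \<epsilon> r" using \<epsilon>_antimono by (auto simp: monotone_on_def)
    have "norm (s r - s t) \<le> norm (s t) / \<epsilon> r * \<bar>\<epsilon> r - \<epsilon> t\<bar>"
      by (rule zero_path_lipschitz) (use rt \<epsilon>_pos zero in auto)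
    also have "\<dots> \<le> norm p / \<epsilon> b * (C * \<bar>r - t\<bar>)"
    proof (intro mult_mono frac_le)
      show "norm (s t) \<le> norm p"
        using zero_path_norm_le(2)[OF _ _ p_zero] rt \<epsilon>_pos zero by auto
      show "\<bar>\<epsilon> r - \<epsilon> t\<bar> \<le> C * \<bar>r - t\<bar>"
        using lipschitz_onD[OF C rt] by (simp add: dist_real_def)
    qed (use b \<epsilon>_pos[of b] in auto)
    finally show "dist (s r) (s t) \<le> norm p / \<epsilon> b * C * dist r t"
      by (simp add: dist_norm dist_real_def mult.assoc)
  next
    show "0 \<le> norm p / \<epsilon> b * C" using C0 \<epsilon>_pos[OF assms] by simp
  qed
  then show ?thesis by blast
qed

text \<open>
  Almost everywhere \<open>ds\<close> agrees with a bounded measurable function \<open>h\<close>, and \<open>R\<close> is continuous on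
  the compact set of the pairs of a time and a vector that satisfies the bound on \<open>h\<close>.
\<close>

lemma residual_integrable:
  assumes b: "b \<ge> t0"
  shows "(\<lambda>t. t\<^sup>2 * R t (ds t)) absolutely_integrable_on {t0..b}"
    "\<exists>N. negligible N \<and> (\<forall>t\<in>{t0<..<b} - N. (s has_vector_derivative ds t) (at t))"
proof -
  obtain C where C: "C-lipschitz_on {t0..b} s" using saddle_path_lipschitz[OF b] by blast
  obtain h N where h: "h integrable_on {t0..b}" and N: "negligible N"
    and der: "\<And>t. t \<in> {t0<..<b} \<Longrightarrow> t \<notin> N \<Longrightarrow> (s has_vector_derivative h t) (at t)"
    and hC: "\<And>t. t \<in> {t0..b} \<Longrightarrow> norm (h t) \<le> C"
    using lipschitz_AE_vector_derivative[OF C b] by metis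
  have ds: "ds t = h t" if "t \<in> {t0<..<b}" "t \<notin> N" for t
    using s_deriv der that by auto
  show "\<exists>N. negligible N \<and> (\<forall>t\<in>{t0<..<b} - N. (s has_vector_derivative ds t) (at t))"
    using N der ds by (intro exI[of _ N]) auto
  have sub: "{t0..b} \<subseteq> {t0..}" by auto
  note cont = C1_from_continuous_on[OF \<alpha> sub] C1_from_continuous_on[OF \<beta> sub]
    C1_from_continuous_on[OF \<epsilon> sub] lipschitz_on_continuous_on[OF C]
  have tp: "t > 0" if "t \<in> {t0..b}" for t using that t0 by auto
  have contl: "continuous_on {t0..b} l"
    unfolding l_def by (intro continuous_intros cont) (use tp \<theta> in force)+
  have cont\<Gamma>: "continuous_on {t0..b} \<Gamma>"
    unfolding \<Gamma>_def by (intro continuous_intros cont) (use tp \<theta> in force)+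
  have contJ: "continuous_on UNIV J" by (rule linear_continuous_on[OF J_linear])
  have nz: "t \<noteq> 0" "l t \<noteq> 0" "\<Gamma> t \<noteq> 0" if "t0 \<le> t" for t
    using that t0 l_pos[OF that] \<Gamma>_pos[OF that] by auto
  have comp: "continuous_on ({t0..b} \<times> cball 0 C) (\<lambda>q. f (fst q))"
    if "continuous_on {t0..b} f" for f :: "real \<Rightarrow> 'z::topological_space"
    by (rule continuous_on_compose2[OF that continuous_on_fst[OF continuous_on_id]]) auto
  let ?Q = "\<lambda>(t, u). t\<^sup>2 * R t u"
  have contQ: "continuous_on ({t0..b} \<times> cball 0 C) ?Q"
    unfolding R_def P_def split_def
    by (intro continuous_intros cont(1,3,6,7)[THEN comp] contl[THEN comp] cont\<Gamma>[THEN comp]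
        bounded_linear.continuous_on[OF J_linear]) (use nz \<theta> in auto)
  have "bounded (?Q ` ({t0..b} \<times> cball 0 C))"
    by (intro compact_imp_bounded compact_continuous_image contQ compact_Times compact_Icc compact_cball)
  then obtain B where "\<forall>r \<in> ?Q ` ({t0..b} \<times> cball 0 C). norm r \<le> B"
    unfolding bounded_iff by blast
  then have B: "norm (t\<^sup>2 * R t u) \<le> B" if "t \<in> {t0..b}" "norm u \<le> C" for t u
    using that bspec[OF _ imageI[of "(t, u)" _ ?Q]] by simp
  have meas: "f \<in> borel_measurable (lebesgue_on {t0..b})" if "continuous_on {t0..b} f"
    for f :: "real \<Rightarrow> 'z::real_normed_vector"
    using that by (rule continuous_imp_measurable_on_sets_lebesgue) simp
  have [measurable]: "h \<in> borel_measurable (lebesgue_on {t0..b})"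
    by (rule integrable_imp_measurable[OF h])
  have [measurable]: "J \<in> borel_measurable borel" using contJ by (rule borel_measurable_continuous_onI)
  note [measurable] = cont[THEN meas] contl[THEN meas] cont\<Gamma>[THEN meas] meas[OF continuous_on_id]
  have "(\<lambda>t. t\<^sup>2 * R t (h t)) \<in> borel_measurable (lebesgue_on {t0..b})"
    unfolding R_def P_def by measurable
  then have "(\<lambda>t. t\<^sup>2 * R t (h t)) absolutely_integrable_on {t0..b}"
    by (rule measurable_bounded_by_integrable_imp_absolutely_integrable[where g="\<lambda>_. B"])
      (use B hC in auto)
  then show "(\<lambda>t. t\<^sup>2 * R t (ds t)) absolutely_integrable_on {t0..b}"
    by (rule absolutely_integrable_spike[where S="N \<union> {t0, b}"]) (use N ds in auto)
qed

text \<open>The energy of the trajectory.\<close>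

definition E :: "real \<Rightarrow> real" where "E = energy \<theta> \<alpha> \<beta> \<epsilon> z v s"

lemma energy_growth:
  assumes b: "b \<ge> t0"
  shows "E b - E t0 \<le> \<theta>\<^sup>2 / 2 * integral {t0..b} (\<lambda>t. t\<^sup>2 * R t (ds t))"
proof -
  have sub: "{t0..b} \<subseteq> {t0..}" by auto
  have lip_z: "\<exists>C. C-lipschitz_on {t0..b} z" and lip_v: "\<exists>C. C-lipschitz_on {t0..b} v"
  proof -
    have z: "(z has_vector_derivative v t) (at t within {t0..b})" if "t \<in> {t0..b}" for t
      using z_deriv[of t] that by (auto intro: has_vector_derivative_within_subset[OF _ sub])
    have v: "(v has_vector_derivative - (\<alpha> t *\<^sub>R v t) -
       \<beta> t *\<^sub>R (G (z t) + \<epsilon> t *\<^sub>R z t + J (z t + (\<theta> * t) *\<^sub>R v t))) (at t within {t0..b})"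
      if "t \<in> {t0..b}" for t
      using v_deriv[of t] that by (auto intro: has_vector_derivative_within_subset[OF _ sub])
    have cz: "continuous_on {t0..b} z" and cv: "continuous_on {t0..b} v"
      using continuous_on_vector_derivative[OF z] continuous_on_vector_derivative[OF v] by simp_all
    show "\<exists>C. C-lipschitz_on {t0..b} z" by (rule lipschitz_C1_Icc[OF z cv])
    show "\<exists>C. C-lipschitz_on {t0..b} v"
      by (rule lipschitz_C1_Icc[OF v])
        (assumption, intro continuous_intros cz cv C1_from_continuous_on(1)[OF \<alpha> sub]
          C1_from_continuous_on(1)[OF \<beta> sub] C1_from_continuous_on(1)[OF \<epsilon> sub]
          continuous_on_compose2[OF G_continuous[of UNIV] cz] bounded_linear.continuous_on[OF J_linear]
          subset_UNIV)
  qed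
  obtain C where C: "C-lipschitz_on {t0..b} E"
    using energy_lipschitz[OF C1_from_lipschitz_Icc[OF \<alpha>] C1_from_lipschitz_Icc[OF \<beta>]
        C1_from_lipschitz_Icc[OF \<epsilon>] lip_z lip_v saddle_path_lipschitz[OF b]] unfolding E_def by blast
  obtain N where N: "negligible N" "\<And>t. t \<in> {t0<..<b} - N \<Longrightarrow> (s has_vector_derivative ds t) (at t)"
    using residual_integrable(2)[OF b] by blast
  have int: "(\<lambda>t. t\<^sup>2 * R t (ds t)) integrable_on {t0..b}"
    using residual_integrable(1)[OF b] set_lebesgue_integral_eq_integral(1) by blast
  have "E b - E t0 \<le> integral {t0..b} (\<lambda>t. \<theta>\<^sup>2 / 2 * (t\<^sup>2 * R t (ds t)))"
  proof (rule lipschitz_growth_le_integral[OF C b _ N(1)])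
    show "(\<lambda>t. \<theta>\<^sup>2 / 2 * (t\<^sup>2 * R t (ds t))) integrable_on {t0..b}"
      using int by (rule integrable_on_mult_right)
    fix t D assume t: "t \<in> {t0<..<b}" "t \<notin> N" and D: "(E has_real_derivative D) (at t)"
    have tt: "t > t0" "t \<ge> t0" "t > 0" using t t0 by auto
    have inner: "at t within {t0..} = at t"
      using tt by (intro at_within_interior) auto
    have z': "(z has_vector_derivative v t) (at t)"
      using z_deriv[OF tt(2)] unfolding inner .
    have v': "(v has_vector_derivative - (\<alpha> t *\<^sub>R v t) -
        \<beta> t *\<^sub>R (G (z t) + \<epsilon> t *\<^sub>R z t + J (z t + (\<theta> * t) *\<^sub>R v t))) (at t)"
      using v_deriv[OF tt(2)] unfolding inner .
    have s': "(s has_vector_derivative ds t) (at t)" using N(2) t by simp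
    note D' = energy_has_derivative[where \<theta>=\<theta>, OF C1_from_has_derivative_at[OF \<alpha> tt(1)]
        C1_from_has_derivative_at[OF \<beta> tt(1)] C1_from_has_derivative_at[OF \<epsilon> tt(1)] z' v' s' zero[OF tt(2)]]
    have "D \<le> \<theta>\<^sup>2 * t\<^sup>2 / 2 * R t (ds t)"
      unfolding DERIV_unique[OF D[unfolded E_def] D'] R_def P_def l_def \<Gamma>_def
      by (rule energy_dissipation[OF zero[OF tt(2)] tt(3) \<theta> \<beta>_pos[OF tt(2)] \<epsilon>_pos[OF tt(2)]
          l_pos[OF tt(2), unfolded l_def] \<Gamma>_pos[OF tt(2), unfolded \<Gamma>_def] \<epsilon>'_nonpos[OF tt(1)] scaling[OF tt(2)]])
    then show "D \<le> \<theta>\<^sup>2 / 2 * (t\<^sup>2 * R t (ds t))" by (simp add: mult.assoc)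
  qed
  then show ?thesis by (simp only: integral_mult_right)
qed

lemma distance_le_energy:
  assumes t: "t \<ge> t0"
  shows "\<theta>\<^sup>2 / 2 * (t\<^sup>2 * \<beta> t * \<epsilon> t) * (norm (z t - s t))\<^sup>2 \<le> E t"
proof -
  have "\<theta>\<^sup>2 * t\<^sup>2 * \<beta> t * (\<epsilon> t / 2 * (norm (z t - s t))\<^sup>2) \<le> \<theta>\<^sup>2 * t\<^sup>2 * \<beta> t * gap (\<epsilon> t) (s t) (z t)"
    using gap_lower[OF zero[OF t]] \<beta>_pos[OF t] by (intro mult_left_mono) auto
  moreover have "0 \<le> (\<theta> * t * \<alpha> t - 1 - \<theta>) / 2 * (norm (z t - s t))\<^sup>2"
    using damping[OF t] by auto
  moreover have "0 \<le> (norm (z t - s t + (\<theta> * t) *\<^sub>R v t))\<^sup>2 / 2" by simp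
  moreover have "\<theta>\<^sup>2 / 2 * (t\<^sup>2 * \<beta> t * \<epsilon> t) * (norm (z t - s t))\<^sup>2 =
      \<theta>\<^sup>2 * t\<^sup>2 * \<beta> t * (\<epsilon> t / 2 * (norm (z t - s t))\<^sup>2)" by simp
  ultimately show ?thesis unfolding E_def energy_def by linarith
qed

theorem trajectory_tendsto:
  assumes \<epsilon>_lim: "(\<epsilon> \<longlongrightarrow> 0) at_top"
    and growth: "filterlim (\<lambda>t. t\<^sup>2 * \<beta> t * \<epsilon> t) at_top at_top"
    and R_lim: "((\<lambda>t. integral {t0..t} (\<lambda>t. t\<^sup>2 * R t (ds t)) / (t\<^sup>2 * \<beta> t * \<epsilon> t)) \<longlongrightarrow> 0) at_top"
  shows "(z \<longlongrightarrow> p) at_top"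
proof -
  define w where "w t = t\<^sup>2 * \<beta> t * \<epsilon> t" for t
  define I where "I t = integral {t0..t} (\<lambda>t. t\<^sup>2 * R t (ds t))" for t
  have ev: "eventually (\<lambda>t. t \<ge> t0) at_top" by (rule eventually_ge_at_top)
  have bound: "(norm (z t - s t))\<^sup>2 \<le> 2 * E t0 / \<theta>\<^sup>2 * inverse (w t) + I t / w t" if t: "t \<ge> t0" for t
  proof -
    have w: "w t > 0" using t t0 \<beta>_pos[OF t] \<epsilon>_pos[OF t] by (auto simp: w_def)
    have "\<theta>\<^sup>2 / 2 * w t * (norm (z t - s t))\<^sup>2 \<le> E t0 + \<theta>\<^sup>2 / 2 * I t"
      using distance_le_energy[OF t] energy_growth[OF t] by (simp add: w_def I_def)
    then show ?thesis using w \<theta> by (simp add: field_simps)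
  qed
  have "((\<lambda>t. 2 * E t0 / \<theta>\<^sup>2 * inverse (w t) + I t / w t) \<longlongrightarrow> 2 * E t0 / \<theta>\<^sup>2 * 0 + 0) at_top"
  proof (intro tendsto_add tendsto_mult tendsto_const tendsto_inverse_0_at_top)
    show "filterlim w at_top at_top" using growth by (simp only: w_def[abs_def])
    show "((\<lambda>t. I t / w t) \<longlongrightarrow> 0) at_top" using R_lim by (simp only: w_def I_def)
  qed
  then have lim: "((\<lambda>t. 2 * E t0 / \<theta>\<^sup>2 * inverse (w t) + I t / w t) \<longlongrightarrow> 0) at_top" by simp
  have "eventually (\<lambda>t. (norm (z t - s t))\<^sup>2 \<le> 2 * E t0 / \<theta>\<^sup>2 * inverse (w t) + I t / w t) at_top"
    using ev by eventually_elim (rule bound)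
  then have "((\<lambda>t. (norm (z t - s t))\<^sup>2) \<longlongrightarrow> 0) at_top"
    by (intro tendsto_sandwich[OF _ _ tendsto_const lim]) simp_all
  from tendsto_real_sqrt[OF this] have "((\<lambda>t. norm (z t - s t)) \<longlongrightarrow> 0) at_top" by simp
  then have zs: "((\<lambda>t. z t - s t) \<longlongrightarrow> 0) at_top" by (rule tendsto_norm_zero_cancel)
  have sp: "(s \<longlongrightarrow> p) at_top"
  proof (rule tendstoI)
    fix \<delta> :: real assume "\<delta> > 0"
    from zero_path_limit[OF p_zero p_min this]
    obtain e0 where "e0 > 0" and e0: "\<forall>e u. 0 < e \<and> e < e0 \<and> F e u = 0 \<longrightarrow> dist u p < \<delta>"
      by auto
    have "eventually (\<lambda>t. \<epsilon> t < e0) at_top" using order_tendstoD(2)[OF \<epsilon>_lim \<open>e0 > 0\<close>] .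
    with ev show "eventually (\<lambda>t. dist (s t) p < \<delta>) at_top"
    proof eventually_elim
      case (elim t)
      then show ?case using e0[rule_format, of "\<epsilon> t" "s t"] \<epsilon>_pos[of t] zero[of t] by blast
    qed
  qed
  from tendsto_add[OF zs sp] show ?thesis by simp
qed

end

section \<open>Saddle points of the regularized Lagrangian\<close>

lemma convex_gradient_inequality:
  fixes f :: "'b::real_inner \<Rightarrow> real"
  assumes conv: "convex_on UNIV f" and grad: "GDERIV f v :> g"
  shows "f v + g \<bullet> (u - v) \<le> f u"
proof -
  define q where "q t = f (v + t *\<^sub>R (u - v))" for t
  have conv_q: "convex_on UNIV q"
  proof (rule convex_onI)
    fix t a b :: real assume t: "0 < t" "t < 1"
    have "v + ((1 - t) * a + t * b) *\<^sub>R (u - v) =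
        (1 - t) *\<^sub>R (v + a *\<^sub>R (u - v)) + t *\<^sub>R (v + b *\<^sub>R (u - v))"
      by (simp add: algebra_simps)
    then show "q ((1 - t) *\<^sub>R a + t *\<^sub>R b) \<le> (1 - t) * q a + t * q b"
      using convex_onD[OF conv, of t "v + a *\<^sub>R (u - v)" "v + b *\<^sub>R (u - v)"] t
      by (simp add: q_def)
  qed simp
  have "((\<lambda>t. v + t *\<^sub>R (u - v)) has_derivative (\<lambda>t. t *\<^sub>R (u - v))) (at 0)"
    by (auto intro!: derivative_eq_intros)
  moreover have "(f has_derivative (\<lambda>h. h \<bullet> g)) (at (v + 0 *\<^sub>R (u - v)))"
    using grad by (simp add: gderiv_def)
  ultimately have "(q has_derivative (\<lambda>t. (t *\<^sub>R (u - v)) \<bullet> g)) (at 0)"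
    unfolding q_def by (rule has_derivative_compose)
  then have "(q has_real_derivative g \<bullet> (u - v)) (at 0)"
    unfolding has_field_derivative_def by (simp add: inner_commute mult_commute_abs)
  from convex_on_imp_above_tangent[OF conv_q _ _ _ this, of 1]
  show ?thesis by (simp add: q_def)
qed

text \<open>
  First-order optimality. The two conditions on a saddle point of the regularized Lagrangian are
  instances with \<open>c = K\<^sup>T y\<close> and \<open>c = - K x\<close>.
\<close>

lemma regularized_minimizer_iff:
  fixes h :: "'b::real_inner \<Rightarrow> real" and c :: 'b
  assumes grad: "GDERIV h x :> g" and ineq: "\<And>u. h x + g \<bullet> (u - x) \<le> h u" and e: "e \<ge> 0"
  shows "(\<forall>u. h x + c \<bullet> x + e / 2 * (norm x)\<^sup>2 \<le> h u + c \<bullet> u + e / 2 * (norm u)\<^sup>2) \<longleftrightarrow>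
    g + c + e *\<^sub>R x = 0" (is "?L \<longleftrightarrow> ?R")
proof
  assume min: ?L
  have "((\<lambda>u. h u + c \<bullet> u + e / 2 * (u \<bullet> u)) has_derivative
      (\<lambda>k. k \<bullet> g + c \<bullet> k + e / 2 * (x \<bullet> k + k \<bullet> x))) (at x)"
    using grad unfolding gderiv_def
    by (intro has_derivative_add has_derivative_inner_right has_derivative_mult_right
        has_derivative_inner has_derivative_ident)
  then have "(\<lambda>k. k \<bullet> g + c \<bullet> k + e / 2 * (x \<bullet> k + k \<bullet> x)) = (\<lambda>k. 0)"
    by (rule has_derivative_local_min) (use min in \<open>auto simp: power2_norm_eq_inner\<close>)
  then have "k \<bullet> g + c \<bullet> k + e / 2 * (x \<bullet> k + k \<bullet> x) = 0" for k by (rule fun_cong)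
  from this[of "g + c + e *\<^sub>R x"] have "(g + c + e *\<^sub>R x) \<bullet> (g + c + e *\<^sub>R x) = 0"
    by (simp add: inner_simps inner_commute algebra_simps)
  then show ?R by simp
next
  assume zero: ?R
  show ?L
  proof
    fix u
    have "(g + c + e *\<^sub>R x) \<bullet> (u - x) = 0" using zero by simp
    then have "g \<bullet> (u - x) = - (c \<bullet> (u - x)) - e * (x \<bullet> (u - x))"
      by (simp only: inner_add_left inner_scaleR_left)
    moreover have "0 \<le> e / 2 * (norm (u - x))\<^sup>2" using e by simp
    moreover have "e / 2 * (norm (u - x))\<^sup>2 = e / 2 * (norm u)\<^sup>2 - e / 2 * (norm x)\<^sup>2 - e * (x \<bullet> (u - x))"
      unfolding power2_norm_eq_inner by (simp add: inner_simps inner_commute field_simps)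
    ultimately show "h x + c \<bullet> x + e / 2 * (norm x)\<^sup>2 \<le> h u + c \<bullet> u + e / 2 * (norm u)\<^sup>2"
      using ineq[of u] by (simp add: inner_diff_right)
  qed
qed

lemma inner_transpose_matrix: "(A *v x) \<bullet> y = (transpose A *v y) \<bullet> x" for A :: "real^'n^'m"
  by (metis dot_lmul_matrix inner_commute transpose_matrix_vector)

lemma reg_lagrangian_zero: "reg_lagrangian f g K 0 = lagrangian f g K"
  by (intro ext) (simp add: reg_lagrangian_def)

lemma saddle_point_reg_lagrangian_iff:
  fixes K :: "real^'n^'m"
  assumes f: "\<And>u. GDERIV f u :> gf u" "convex_on UNIV f"
    and g: "\<And>v. GDERIV g v :> gg v" "convex_on UNIV g" and e: "e \<ge> 0"
  shows "saddle_point (reg_lagrangian f g K e) (x, y) \<longleftrightarrow>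
    gf x + transpose K *v y + e *\<^sub>R x = 0 \<and> gg y - K *v x + e *\<^sub>R y = 0"
proof -
  have "saddle_point (reg_lagrangian f g K e) (x, y) \<longleftrightarrow>
    (\<forall>u. f x + (transpose K *v y) \<bullet> x + e / 2 * (norm x)\<^sup>2 \<le> f u + (transpose K *v y) \<bullet> u + e / 2 * (norm u)\<^sup>2) \<and>
    (\<forall>u. g y + (- (K *v x)) \<bullet> y + e / 2 * (norm y)\<^sup>2 \<le> g u + (- (K *v x)) \<bullet> u + e / 2 * (norm u)\<^sup>2)"
    unfolding saddle_point_def reg_lagrangian_def lagrangian_def fst_conv snd_conv inner_transpose_matrix[symmetric]
    by (auto simp: algebra_simps)
  also have "\<dots> \<longleftrightarrow> gf x + transpose K *v y + e *\<^sub>R x = 0 \<and> gg y + - (K *v x) + e *\<^sub>R y = 0"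
    by (simp only: regularized_minimizer_iff[OF f(1) convex_gradient_inequality[OF f(2,1)] e]
        regularized_minimizer_iff[OF g(1) convex_gradient_inequality[OF g(2,1)] e])
  finally show ?thesis by simp
qed

lemma skew_gradient_lagrangian:
  fixes K :: "real^'n^'m"
  assumes f: "\<And>u. GDERIV f u :> gf u" "convex_on UNIV f" "L1-lipschitz_on UNIV gf"
    and g: "\<And>v. GDERIV g v :> gg v" "convex_on UNIV g" "L2-lipschitz_on UNIV gg"
  shows "skew_gradient (\<lambda>q. f (fst q) + g (snd q)) (\<lambda>q. (gf (fst q), gg (snd q)))
    (\<lambda>q. (transpose K *v snd q, - (K *v fst q))) (sqrt (L1\<^sup>2 + L2\<^sup>2))"
proof (rule skew_gradient.intro)
  fix u v :: "(real^'n) \<times> (real^'m)"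
  show "GDERIV (\<lambda>q. f (fst q) + g (snd q)) v :> (gf (fst v), gg (snd v))"
  proof -
    have "((\<lambda>q. f (fst q)) has_derivative (\<lambda>h. fst h \<bullet> gf (fst v))) (at v)"
      using f(1)[of "fst v"] unfolding gderiv_def
      by (intro has_derivative_compose[OF has_derivative_fst[OF has_derivative_ident]])
    moreover have "((\<lambda>q. g (snd q)) has_derivative (\<lambda>h. snd h \<bullet> gg (snd v))) (at v)"
      using g(1)[of "snd v"] unfolding gderiv_def
      by (intro has_derivative_compose[OF has_derivative_snd[OF has_derivative_ident]])
    ultimately show ?thesis
      unfolding gderiv_def inner_prod_def fst_conv snd_conv by (rule has_derivative_add)
  qed
  show "f (fst v) + g (snd v) + (gf (fst v), gg (snd v)) \<bullet> (u - v) \<le> f (fst u) + g (snd u)"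
    using convex_gradient_inequality[OF f(2,1), of "fst v" "fst u"]
      convex_gradient_inequality[OF g(2,1), of "snd v" "snd u"]
    by (simp add: inner_prod_def)
  show "(sqrt (L1\<^sup>2 + L2\<^sup>2))-lipschitz_on UNIV (\<lambda>q. (gf (fst q), gg (snd q)))"
  proof (rule lipschitz_on_Pair)
    show "L1-lipschitz_on UNIV (\<lambda>q :: (real^'n) \<times> (real^'m). gf (fst q))"
    proof (rule lipschitz_onI)
      fix p q :: "(real^'n) \<times> (real^'m)"
      have "dist (gf (fst p)) (gf (fst q)) \<le> L1 * dist (fst p) (fst q)"
        by (rule lipschitz_onD[OF f(3)]) auto
      also have "\<dots> \<le> L1 * dist p q"
        using lipschitz_on_nonneg[OF f(3)] by (intro mult_left_mono dist_fst_le)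
      finally show "dist (gf (fst p)) (gf (fst q)) \<le> L1 * dist p q" .
    qed (rule lipschitz_on_nonneg[OF f(3)])
    show "L2-lipschitz_on UNIV (\<lambda>q :: (real^'n) \<times> (real^'m). gg (snd q))"
    proof (rule lipschitz_onI)
      fix p q :: "(real^'n) \<times> (real^'m)"
      have "dist (gg (snd p)) (gg (snd q)) \<le> L2 * dist (snd p) (snd q)"
        by (rule lipschitz_onD[OF g(3)]) auto
      also have "\<dots> \<le> L2 * dist p q"
        using lipschitz_on_nonneg[OF g(3)] by (intro mult_left_mono dist_snd_le)
      finally show "dist (gg (snd p)) (gg (snd q)) \<le> L2 * dist p q" .
    qed (rule lipschitz_on_nonneg[OF g(3)])
  qed
  show "bounded_linear (\<lambda>q :: (real^'n) \<times> (real^'m). (transpose K *v snd q, - (K *v fst q)))"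
    by (intro bounded_linear_Pair bounded_linear_minus bounded_linear_compose[OF matrix_vector_mul_bounded_linear]
        bounded_linear_fst bounded_linear_snd)
  show "(transpose K *v snd u, - (K *v fst u)) \<bullet> u = 0"
    using inner_transpose_matrix[of K "fst u" "snd u"] by (simp add: inner_prod_def del: transpose_matrix_vector)
qed

section \<open>Convergence of the primal-dual system\<close>

lemma W11_loc_from_continuous_on:
  assumes "W11_loc_from a u w"
  shows "continuous_on {a..b} u"
proof (cases "a \<le> b")
  case True
  have int: "set_integrable lebesgue {a..t} w" if "t \<ge> a" for t
    using assms that unfolding W11_loc_from_def by blast
  have "continuous_on {a..b} (\<lambda>t. u a + integral {a..t} w)"
    using set_lebesgue_integral_eq_integral(1)[OF int[OF True]]
    by (intro continuous_on_add continuous_on_const indefinite_integral_continuous_1)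
  moreover have "u a + integral {a..t} w = u t" if "t \<in> {a..b}" for t
  proof -
    have ta: "t \<ge> a" using that by simp
    have "u t = u a + (LINT r:{a..t}|lebesgue. w r)" using assms ta unfolding W11_loc_from_def by blast
    then show ?thesis unfolding set_lebesgue_integral_eq_integral(2)[OF int[OF ta]] by (rule sym)
  qed
  ultimately show ?thesis by (rule continuous_on_eq)
qed simp

text \<open>
  If the weak derivative of \<open>u\<close> agrees almost everywhere with a continuous function, then \<open>u\<close> is
  classically differentiable.
\<close>

lemma W11_loc_from_has_derivative:
  assumes W: "W11_loc_from a u w" and ae: "AE t in lebesgue. t > a \<longrightarrow> w t = w' t"
    and cont: "\<And>b. continuous_on {a..b} w'" and t: "t \<ge> a"
  shows "(u has_vector_derivative w' t) (at t within {a..})"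
proof -
  obtain N where N: "negligible N" "\<And>t. t \<notin> N \<Longrightarrow> t > a \<Longrightarrow> w t = w' t"
  proof -
    obtain N where "\<And>t. t \<in> space lebesgue - N \<Longrightarrow> t > a \<longrightarrow> w t = w' t" "N \<in> null_sets lebesgue"
      using AE_E3[OF ae] by blast
    then show ?thesis by (intro that[of N]) (simp_all add: negligible_iff_null_sets)
  qed
  have u: "u r = u a + integral {a..r} w'" if r: "r \<ge> a" for r
  proof -
    have "u r = u a + integral {a..r} w"
    proof -
      have int: "set_integrable lebesgue {a..r} w" and "u r = u a + (LINT r:{a..r}|lebesgue. w r)"
        using W r unfolding W11_loc_from_def by blast+
      then show ?thesis by (simp only: set_lebesgue_integral_eq_integral(2)[OF int])
    qed
    also have "integral {a..r} w = integral {a..r} w'"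
      by (rule integral_spike[of "insert a N"]) (use N in auto)
    finally show ?thesis .
  qed
  have "((\<lambda>r. u a + integral {a..r} w') has_vector_derivative w' t) (at t within {a..t + 1})"
    using has_vector_derivative_add[OF has_vector_derivative_const
        integral_has_vector_derivative[OF cont[of "t + 1"], of t], of "u a"] t by simp
  moreover have "at t within {a..t + 1} = at t within {a..}"
    by (rule at_within_nhd[of _ "{..<t + 1}"]) auto
  ultimately have "((\<lambda>r. u a + integral {a..r} w') has_vector_derivative w' t) (at t within {a..})" by simp
  then show ?thesis
  proof (rule has_vector_derivative_transform[rotated 2])
    show "u r = u a + integral {a..r} w'" if "r \<in> {a..}" for r
      using that by (intro u) simp
  qed (use t in simp)
qed

theorem theorem4p1:
  fixes f :: "real^'n \<Rightarrow> real" and gf :: "real^'n \<Rightarrow> real^'n" and L1 :: real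
    and g :: "real^'m \<Rightarrow> real" and gg :: "real^'m \<Rightarrow> real^'m" and L2 :: real
    and K :: "real^'n^'m"
    and t0 \<theta> :: real
    and \<alpha> \<alpha>' \<beta> \<beta>' \<epsilon> \<epsilon>' l \<Gamma> R :: "real \<Rightarrow> real"
    and \<Omega> :: "((real^'n) \<times> (real^'m)) set"
    and xt dxt Px :: "real \<Rightarrow> real^'n" and yt dyt Py :: "real \<Rightarrow> real^'m"
    and x :: "real \<Rightarrow> real^'n" and y :: "real \<Rightarrow> real^'m"
  assumes f_convex: "convex_on UNIV f"
    and f_grad: "\<And>u. GDERIV f u :> gf u" and f_C1: "continuous_on UNIV gf"
    and f_lip: "L1-lipschitz_on UNIV gf" and L1_pos: "L1 > 0"
    and g_convex: "convex_on UNIV g"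
    and g_grad: "\<And>v. GDERIV g v :> gg v" and g_C1: "continuous_on UNIV gg"
    and g_lip: "L2-lipschitz_on UNIV gg" and L2_pos: "L2 > 0"
    and t0: "t0 \<ge> 1" and \<theta>_pos: "\<theta> > 0"
    and \<alpha>_C1: "C1_from t0 \<alpha> \<alpha>'" and \<alpha>_pos: "\<And>t. t \<ge> t0 \<Longrightarrow> \<alpha> t > 0"
    and \<beta>_C1: "C1_from t0 \<beta> \<beta>'" and \<beta>_pos: "\<And>t. t \<ge> t0 \<Longrightarrow> \<beta> t > 0"
    and \<epsilon>_C1: "C1_from t0 \<epsilon> \<epsilon>'" and \<epsilon>_pos: "\<And>t. t \<ge> t0 \<Longrightarrow> \<epsilon> t > 0"
    and \<epsilon>_antimono: "antimono_on {t0..} \<epsilon>" and \<epsilon>_lim: "(\<epsilon> \<longlongrightarrow> 0) at_top"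
    and \<Omega>_def: "\<Omega> = saddle_points (lagrangian f g K)"
    and \<Omega>_props: "\<Omega> \<noteq> {}" "closed \<Omega>" "convex \<Omega>"
    and cond1: "\<And>t. t \<ge> t0 \<Longrightarrow> 1 + \<theta> - \<theta> * t * \<alpha> t < 0"
    and cond2: "\<And>t. t \<ge> t0 \<Longrightarrow> (2 * \<theta> - 1) * \<beta> t + \<theta> * t * \<beta>' t \<le> 0"
    and cond3: "\<And>t. t \<ge> t0 \<Longrightarrow> \<alpha> t + t * \<alpha>' t < t * \<beta> t * \<epsilon> t"
    and cond4: "filterlim (\<lambda>t. t\<^sup>2 * \<beta> t * \<epsilon> t) at_top at_top"
    and xt_yt: "\<And>t. t \<ge> t0 \<Longrightarrow> (xt t, yt t) = reg_saddle f g K (\<epsilon> t)"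
    and dxt: "\<And>t. t \<ge> t0 \<Longrightarrow> dxt t = vector_derivative xt (at t)"
    and dyt: "\<And>t. t \<ge> t0 \<Longrightarrow> dyt t = vector_derivative yt (at t)"
    and l_def: "\<And>t. t \<ge> t0 \<Longrightarrow> l t = 1 / (\<theta> * t) * (\<beta> t * \<epsilon> t - \<alpha>' t - \<alpha> t / t)"
    and \<Gamma>_def: "\<And>t. t \<ge> t0 \<Longrightarrow> \<Gamma> t = \<alpha> t - (1 + \<theta>) / (\<theta> * t)"
    and Px_def: "\<And>t. t \<ge> t0 \<Longrightarrow>
      Px t = - (\<beta> t *\<^sub>R (transpose K *v dyt t)) - (\<beta> t * \<epsilon>' t) *\<^sub>R xt t
             + ((\<alpha> t - 1 / t) / (\<theta> * t)) *\<^sub>R dxt t"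
    and Py_def: "\<And>t. t \<ge> t0 \<Longrightarrow>
      Py t = \<beta> t *\<^sub>R (K *v dxt t) - (\<beta> t * \<epsilon>' t) *\<^sub>R yt t
             + ((\<alpha> t - 1 / t) / (\<theta> * t)) *\<^sub>R dyt t"
    and R_def: "\<And>t. t \<ge> t0 \<Longrightarrow>
      R t = ((norm (Px t))\<^sup>2 + (norm (Py t))\<^sup>2) / l t
            + ((norm (dxt t))\<^sup>2 + (norm (dyt t))\<^sup>2) / (2 * \<theta>\<^sup>2 * t\<^sup>2 * \<Gamma> t)"
    and R_lim: "((\<lambda>t. (LINT \<tau>:{t0..t}|lebesgue. \<tau>\<^sup>2 * R \<tau>) / (t\<^sup>2 * \<beta> t * \<epsilon> t)) \<longlongrightarrow> 0) at_top"
    and sol: "gtrd_solution gf gg K t0 \<theta> \<alpha> \<beta> \<epsilon> x y"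
  shows "((\<lambda>t. norm ((x t, y t) - closest_point \<Omega> 0)) \<longlongrightarrow> 0) at_top"
proof -
  define \<phi> where "\<phi> q = f (fst q) + g (snd q)" for q :: "(real^'n) \<times> (real^'m)"
  define G where "G q = (gf (fst q), gg (snd q))" for q :: "(real^'n) \<times> (real^'m)"
  define J where "J q = (transpose K *v snd q, - (K *v fst q))" for q :: "(real^'n) \<times> (real^'m)"
  define L where "L = sqrt (L1\<^sup>2 + L2\<^sup>2)"
  have sg: "skew_gradient \<phi> G J L"
    using skew_gradient_lagrangian[OF f_grad f_convex f_lip g_grad g_convex g_lip, of K]
    unfolding \<phi>_def[abs_def] G_def[abs_def] J_def[abs_def] L_def .
  let ?F = "skew_gradient.F G J"
  have saddle_iff: "saddle_point (reg_lagrangian f g K e) q \<longleftrightarrow> ?F e q = 0" if "e \<ge> 0" for e q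
    using saddle_point_reg_lagrangian_iff[OF f_grad f_convex g_grad g_convex that, of K "fst q" "snd q"]
    by (simp add: skew_gradient.F_def[OF sg] G_def J_def prod_eq_iff del: transpose_matrix_vector)
  have zero: "?F e (reg_saddle f g K e) = 0" if e: "e > 0" for e
  proof -
    have "\<exists>!q. saddle_point (reg_lagrangian f g K e) q"
      using skew_gradient.F_zero_exists[OF sg e] skew_gradient.F_zero_unique[OF sg e] saddle_iff e by (metis less_imp_le)
    then have "saddle_point (reg_lagrangian f g K e) (reg_saddle f g K e)"
      unfolding reg_saddle_def by (rule theI')
    then show ?thesis using saddle_iff[of e] e by simp
  qed
  define p where "p = closest_point \<Omega> 0"
  have \<Omega>_iff: "q \<in> \<Omega> \<longleftrightarrow> ?F 0 q = 0" for q
    unfolding \<Omega>_def saddle_points_def using saddle_iff[of 0 q] by (simp add: reg_lagrangian_zero)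
  have p: "?F 0 p = 0"
    using closest_point_exists(1)[OF \<Omega>_props(2,1)] by (simp add: p_def \<Omega>_iff)
  have p_min: "norm p \<le> norm w" if "?F 0 w = 0" for w
    using closest_point_exists(2)[OF \<Omega>_props(2,1), of 0] that by (simp add: p_def \<Omega>_iff)
  obtain x' x'' y' y'' where W: "W11_loc_from t0 x x'" "W11_loc_from t0 x' x''"
      "W11_loc_from t0 y y'" "W11_loc_from t0 y' y''"
    and ode: "AE t in lebesgue. t > t0 \<longrightarrow>
           x'' t + \<alpha> t *\<^sub>R x' t
             + \<beta> t *\<^sub>R grad_x_reg gf K (\<epsilon> t) (x t) (y t + (\<theta> * t) *\<^sub>R y' t) = 0 \<and>
           y'' t + \<alpha> t *\<^sub>R y' t
             - \<beta> t *\<^sub>R grad_y_reg gg K (\<epsilon> t) (x t + (\<theta> * t) *\<^sub>R x' t) (y t) = 0"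
    using sol unfolding gtrd_solution_def by blast
  \<comment> \<open>The accelerations prescribed by the system. They are continuous, so \<open>x\<close> and \<open>y\<close> are twice
    continuously differentiable.\<close>
  define ax where "ax t = - (\<alpha> t *\<^sub>R x' t) -
    \<beta> t *\<^sub>R (gf (x t) + transpose K *v (y t + (\<theta> * t) *\<^sub>R y' t) + \<epsilon> t *\<^sub>R x t)" for t
  define ay where "ay t = - (\<alpha> t *\<^sub>R y' t) +
    \<beta> t *\<^sub>R (- gg (y t) + K *v (x t + (\<theta> * t) *\<^sub>R x' t) - \<epsilon> t *\<^sub>R y t)" for t
  note cW = W[THEN W11_loc_from_continuous_on]
  have cC: "continuous_on {t0..b} \<alpha>" "continuous_on {t0..b} \<beta>" "continuous_on {t0..b} \<epsilon>" for b
    by (rule C1_from_continuous_on(1)[OF \<alpha>_C1] C1_from_continuous_on(1)[OF \<beta>_C1]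
        C1_from_continuous_on(1)[OF \<epsilon>_C1]; auto)+
  have cax: "continuous_on {t0..b} ax" for b
    unfolding ax_def
    by (intro continuous_intros cW cC continuous_on_compose2[OF f_C1 cW(1)] subset_UNIV
        bounded_linear.continuous_on[OF matrix_vector_mul_bounded_linear])
  have cay: "continuous_on {t0..b} ay" for b
    unfolding ay_def
    by (intro continuous_intros cW cC continuous_on_compose2[OF g_C1 cW(3)] subset_UNIV
        bounded_linear.continuous_on[OF matrix_vector_mul_bounded_linear])
  have aex: "AE t in lebesgue. t > t0 \<longrightarrow> x'' t = ax t"
    using ode by eventually_elim (simp add: ax_def grad_x_reg_def eq_neg_iff_add_eq_0 algebra_simps
        del: transpose_matrix_vector)
  have aey: "AE t in lebesgue. t > t0 \<longrightarrow> y'' t = ay t"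
    using ode by eventually_elim (simp add: ay_def grad_y_reg_def eq_neg_iff_add_eq_0 algebra_simps)
  have dx: "(x has_vector_derivative x' t) (at t within {t0..})"
    and dy: "(y has_vector_derivative y' t) (at t within {t0..})"
    and dx': "(x' has_vector_derivative ax t) (at t within {t0..})"
    and dy': "(y' has_vector_derivative ay t) (at t within {t0..})" if "t \<ge> t0" for t
    by (rule W11_loc_from_has_derivative[OF W(1) _ cW(2) that] W11_loc_from_has_derivative[OF W(3) _ cW(4) that]
        W11_loc_from_has_derivative[OF W(2) aex cax that] W11_loc_from_has_derivative[OF W(4) aey cay that]; simp)+
  define z where "z t = (x t, y t)" for t
  define v where "v t = (x' t, y' t)" for t
  define s where "s t = (xt t, yt t)" for t
  define ds where "ds t = (dxt t, dyt t)" for t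
  have tr: "gtrd_trajectory \<phi> G J L t0 \<theta> \<alpha> \<alpha>' \<beta> \<beta>' \<epsilon> \<epsilon>' z v s ds p"
  proof (intro gtrd_trajectory.intro gtrd_trajectory_axioms.intro sg)
    fix t assume t: "t \<ge> t0"
    show "?F (\<epsilon> t) (s t) = 0" using zero[OF \<epsilon>_pos[OF t]] xt_yt[OF t] by (simp add: s_def)
    show "(z has_vector_derivative v t) (at t within {t0..})"
      unfolding z_def v_def by (intro has_vector_derivative_Pair dx dy t)
    have "(ax t, ay t) = - (\<alpha> t *\<^sub>R v t) - \<beta> t *\<^sub>R (G (z t) + \<epsilon> t *\<^sub>R z t + J (z t + (\<theta> * t) *\<^sub>R v t))"
      by (simp add: ax_def ay_def v_def z_def G_def J_def algebra_simps del: transpose_matrix_vector)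
    then show "(v has_vector_derivative
        - (\<alpha> t *\<^sub>R v t) - \<beta> t *\<^sub>R (G (z t) + \<epsilon> t *\<^sub>R z t + J (z t + (\<theta> * t) *\<^sub>R v t))) (at t within {t0..})"
      using has_vector_derivative_Pair[OF dx'[OF t] dy'[OF t]] unfolding v_def by simp
  next
    fix t D assume t: "t > t0" and D: "(s has_vector_derivative D) (at t)"
    have "(xt has_vector_derivative fst D) (at t)" "(yt has_vector_derivative snd D) (at t)"
      using bounded_linear.has_vector_derivative[OF bounded_linear_fst D]
        bounded_linear.has_vector_derivative[OF bounded_linear_snd D] by (simp_all add: s_def)
    then show "ds t = D"
      using dxt[of t] dyt[of t] t by (simp add: ds_def vector_derivative_at)
  qed (fact | erule \<beta>_pos \<epsilon>_pos cond1 cond2 cond3 p_min)+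
  let ?P = "gtrd_trajectory.P J \<theta> \<alpha> \<beta> \<epsilon>' s"
  let ?R = "gtrd_trajectory.R J \<theta> \<alpha> \<alpha>' \<beta> \<epsilon> \<epsilon>' s"
  have R_eq: "R t = ?R t (ds t)" if t: "t \<ge> t0" for t
  proof -
    have "?P t (ds t) = (Px t, Py t)"
      unfolding gtrd_trajectory.P_def[OF tr] Px_def[OF t] Py_def[OF t] ds_def s_def J_def by simp
    then show ?thesis
      unfolding R_def[OF t] gtrd_trajectory.R_def[OF tr] gtrd_trajectory.l_def[OF tr] gtrd_trajectory.\<Gamma>_def[OF tr] l_def[OF t] \<Gamma>_def[OF t]
      by (simp add: ds_def norm_Pair)
  qed
  have int_eq: "(LINT \<tau>:{t0..t}|lebesgue. \<tau>\<^sup>2 * R \<tau>) = integral {t0..t} (\<lambda>\<tau>. \<tau>\<^sup>2 * ?R \<tau> (ds \<tau>))"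
    if t: "t \<ge> t0" for t
  proof -
    have "(LINT \<tau>:{t0..t}|lebesgue. \<tau>\<^sup>2 * R \<tau>) = (LINT \<tau>:{t0..t}|lebesgue. \<tau>\<^sup>2 * ?R \<tau> (ds \<tau>))"
      by (rule set_lebesgue_integral_cong) (simp_all add: R_eq)
    also have "\<dots> = integral {t0..t} (\<lambda>\<tau>. \<tau>\<^sup>2 * ?R \<tau> (ds \<tau>))"
      by (rule set_lebesgue_integral_eq_integral(2)[OF gtrd_trajectory.residual_integrable(1)[OF tr t]])
    finally show ?thesis .
  qed
  \<comment> \<open>The two quotients agree only for \<open>t \<ge> t0\<close>, where \<open>R\<close> is determined.\<close>
  have "eventually (\<lambda>t. (LINT \<tau>:{t0..t}|lebesgue. \<tau>\<^sup>2 * R \<tau>) / (t\<^sup>2 * \<beta> t * \<epsilon> t) =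
      integral {t0..t} (\<lambda>\<tau>. \<tau>\<^sup>2 * ?R \<tau> (ds \<tau>)) / (t\<^sup>2 * \<beta> t * \<epsilon> t)) at_top"
    using eventually_ge_at_top[of t0] by eventually_elim (simp only: int_eq)
  with R_lim have "((\<lambda>t. integral {t0..t} (\<lambda>\<tau>. \<tau>\<^sup>2 * ?R \<tau> (ds \<tau>)) / (t\<^sup>2 * \<beta> t * \<epsilon> t)) \<longlongrightarrow> 0) at_top"
    by (simp only: tendsto_cong)
  from gtrd_trajectory.trajectory_tendsto[OF tr \<epsilon>_lim cond4 this]
  have "((\<lambda>t. z t - p) \<longlongrightarrow> 0) at_top" by (simp only: LIM_zero)
  then show ?thesis unfolding z_def p_def by (rule tendsto_norm_zero)
qed

end
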